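(* For every finite input set $X$ of distinct elements, the expected number of comparisons in which the minimum of $X$ participates during the randomized algorithm $\textsc{SampleMinimum}(X)$ (defined in the context) is at most $9$.
   Context: Elements come from a totally ordered set and are accessed only through comparisons. $\textsc{TournamentMinimum}(Y)$ is a deterministic procedure returning the smallest and second smallest elements of $Y$ via a balanced tournament (knock-out) tree: the minimum is found by a balanced tournament tree, in which the minimum participates in at most $\lceil\log_2|Y|\rceil$ comparisons, and the second smallest is then determined among the elements that lost directly to the minimum without further comparisons involving the minimum (missing values, e.g. when $|Y|\le 1$, are treated as $+\infty$). $\textsc{SampleMinimum}(X)$, which returns the smallest and second smallest element of $X$, is: (1) if $|X|\le 8$ return $\textsc{TournamentMinimum}(X)$; (2) let $A\subset X$ be a uniformly random subset with $|A|=\lceil |X|/2\rceil$; (3) let $B\subset A$ be a uniformly random subset of $A$ with $|B|=\lfloor |X|^{2/3}\rfloor$; (4) $(b_1,b_2)=\textsc{SampleMinimum}(B)$; (5) let $D=\{x\in A\setminus B : x<b_2\}$ (each such $x$ compared with $b_2$); (6) $(a_1',a_2')=\textsc{SampleMinimum}(D)$; (7) $(a_1,a_2)=\textsc{TournamentMinimum}(a_1',a_2',b_1,b_2)$; (8) let $C=\{x\in X\setminus A : x<a_2\}$ (each such $x$ compared with $a_2$); (9) $(c_1,c_2)=\textsc{TournamentMinimum}(C)$; (10) return $\textsc{TournamentMinimum}(a_1,a_2,c_1,c_2)$. *)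

theory Defs
  imports "HOL-Probability.Probability"
begin

text \<open>
  Every procedure returns its result together with the multiset of all comparisons it has
  performed; a comparison of \<open>x\<close> with \<open>y\<close> is logged as the pair \<open>(x, y)\<close>, and repeated comparisons
  are counted repeatedly.  Smallest and second smallest elements have type \<open>'a option\<close>, where
  \<open>None\<close> stands for a missing value, i.e. for \<open>+\<infinity>\<close>.  Missing values are not elements, so they do
  not take part in any comparison.
\<close>

type_synonym 'a comparisons = "('a \<times> 'a) multiset"
type_synonym 'a two_smallest = "'a option \<times> 'a option"

text \<open>
  The knock-out tournament on a nonempty list: the two halves play their own tournaments and the
  two winners are then compared.  The result is the winner, the elements that lost directly
  to the winner, and the comparisons.
\<close>

fun knockout :: "'a::linorder list \<Rightarrow> 'a \<times> 'a list \<times> 'a comparisons" where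
  "knockout xs =
    (if length xs \<le> 1 then (hd xs, [], {#})
     else
       let k = (length xs + 1) div 2;
           (v, ls, cs) = knockout (take k xs);
           (w, ms, ds) = knockout (drop k xs)
       in if v < w then (v, ls @ [w], cs + ds + {#(v, w)#})
          else (w, ms @ [v], cs + ds + {#(v, w)#}))"

declare knockout.simps [simp del]

definition tournament_minimum :: "'a::linorder list \<Rightarrow> 'a two_smallest \<times> 'a comparisons" where
  "tournament_minimum xs =
    (if xs = [] then ((None, None), {#})
     else
       let (m, ls, cs) = knockout xs
       in if ls = [] then ((Some m, None), cs)
          else let (s, _, ds) = knockout ls in ((Some m, Some s), cs + ds))"

definition present :: "'a option list \<Rightarrow> 'a list" where
  "present ys = map the (filter (\<lambda>y. y \<noteq> None) ys)"

text \<open>The elements of \<open>S\<close> below the pivot, each element of \<open>S\<close> being compared with the pivot.\<close>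

definition below :: "'a::linorder option \<Rightarrow> 'a set \<Rightarrow> 'a set \<times> 'a comparisons" where
  "below p S =
    (case p of
       None \<Rightarrow> (S, {#})
     | Some b \<Rightarrow> ({x \<in> S. x < b}, image_mset (\<lambda>x. (x, b)) (mset_set S)))"

definition random_subset :: "nat \<Rightarrow> 'a set \<Rightarrow> 'a set pmf" where
  "random_subset k S = pmf_of_set {T. T \<subseteq> S \<and> card T = k}"

text \<open>\<open>pmf_of_set\<close> is meaningful only for a finite nonempty set, which is the case here:\<close>

lemma set_random_subset:
  assumes "finite S" "k \<le> card S"
  shows "set_pmf (random_subset k S) = {T. T \<subseteq> S \<and> card T = k}"
proof -
  have "finite {T. T \<subseteq> S \<and> card T = k}"
    using assms(1) by (rule rev_finite_subset[OF finite_Pow_iff[THEN iffD2]]) auto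
  moreover have "{T. T \<subseteq> S \<and> card T = k} \<noteq> {}"
    using obtain_subset_with_card_n[OF assms(2)] by blast
  ultimately show ?thesis
    unfolding random_subset_def by (simp add: set_pmf_of_set)
qed

definition half_size :: "nat \<Rightarrow> nat" where
  "half_size n = nat \<lceil>real n / 2\<rceil>"

definition sample_size :: "nat \<Rightarrow> nat" where
  "sample_size n = nat \<lfloor>real n powr (2/3)\<rfloor>"

lemma half_size_less: "8 < n \<Longrightarrow> half_size n < n"
  unfolding half_size_def by linarith

lemma sample_size_le_half_size:
  assumes "8 < n"
  shows "sample_size n \<le> half_size n"
proof -
  have "real n powr (2/3) \<le> real n / 2"
  proof -
    have "(8::real) powr (1/3) \<le> real n powr (1/3)"
      using assms by (intro powr_mono2) auto
    moreover have "(8::real) powr (1/3) = 2"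
    proof -
      have "(8::real) = 2 powr 3" by simp
      then show ?thesis by (simp only: powr_powr) simp
    qed
    ultimately have "2 * real n powr (2/3) \<le> real n powr (1/3) * real n powr (2/3)"
      by (intro mult_right_mono) auto
    also have "\<dots> = real n"
      using assms by (simp add: powr_add[symmetric])
    finally show ?thesis by simp
  qed
  then show ?thesis
    unfolding sample_size_def half_size_def by linarith
qed

text \<open>
  The input of a tournament on a set is placed at the leaves of the tournament tree in an
  arbitrary order; \<open>arr Y\<close> is the list of the elements of \<open>Y\<close> in the order that is used.
\<close>

definition arrangement :: "('a set \<Rightarrow> 'a list) \<Rightarrow> bool" where
  "arrangement arr \<longleftrightarrow> (\<forall>Y. finite Y \<longrightarrow> distinct (arr Y) \<and> set (arr Y) = Y)"

function sample_minimum ::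
  "('a::linorder set \<Rightarrow> 'a list) \<Rightarrow> 'a set \<Rightarrow> ('a two_smallest \<times> 'a comparisons) pmf" where
  "sample_minimum arr X =
    (if card X \<le> 8 then return_pmf (tournament_minimum (arr X))
     else do {
       A \<leftarrow> random_subset (half_size (card X)) X;
       B \<leftarrow> random_subset (sample_size (card X)) A;
       ((b1, b2), cmpB) \<leftarrow> sample_minimum arr B;
       let (D, cmpb2) = below b2 (A - B);
       ((a1', a2'), cmpD) \<leftarrow> sample_minimum arr D;
       let ((a1, a2), cmpA) = tournament_minimum (present [a1', a2', b1, b2]);
       let (C, cmpa2) = below a2 (X - A);
       let ((c1, c2), cmpC) = tournament_minimum (arr C);
       let (res, cmp) = tournament_minimum (present [a1, a2, c1, c2]);
       return_pmf (res, cmpB + cmpb2 + cmpD + cmpA + cmpa2 + cmpC + cmp)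
     })"
  by pat_completeness auto

termination
proof (relation "Wellfounded.measure (\<lambda>(arr, X). card X)", goal_cases)
  case 1
  show ?case by simp
next
  case (2 arr X A B)
  then have X: "8 < card X" "finite X"
    by (auto intro: card_ge_0_finite)
  have A: "A \<subseteq> X" "card A = half_size (card X)"
    using 2(2) set_random_subset[OF X(2)] half_size_less[OF X(1)] by auto
  have "finite A" using A(1) X(2) finite_subset by blast
  then have "card B = sample_size (card X)"
    using 2(3) set_random_subset[of A "sample_size (card X)"]
      sample_size_le_half_size[OF X(1)] A(2) by auto
  then show ?case
    using sample_size_le_half_size[OF X(1)] half_size_less[OF X(1)] by simp
next
  case (3 arr X A B e p cmpB b1 b2 q r D cmpb2)
  then have X: "8 < card X" "finite X"
    by (auto intro: card_ge_0_finite)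
  have A: "A \<subseteq> X" "card A = half_size (card X)"
    using 3(2) set_random_subset[OF X(2)] half_size_less[OF X(1)] by auto
  have "finite A" using A(1) X(2) finite_subset by blast
  have "D \<subseteq> A"
    using 3 by (auto simp: below_def split: option.splits)
  then have "card D \<le> card A"
    using \<open>finite A\<close> by (rule card_mono[rotated])
  then show ?case
    using A(2) half_size_less[OF X(1)] by simp
qed

declare sample_minimum.simps [simp del]

text \<open>
  The output distribution has finite support, so every real-valued function of the outcome is
  integrable and its expectation is a genuine one.
\<close>

lemma finite_set_sample_minimum:
  "finite X \<Longrightarrow> finite (set_pmf (sample_minimum arr X))"
proof (induction "card X" arbitrary: X rule: less_induct)
  case less
  show ?case
  proof (cases "card X \<le> 8")
    case True
    then show ?thesis by (simp add: sample_minimum.simps[of arr X])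
  next
    case False
    then have X: "8 < card X" by simp
    let ?RA = "random_subset (half_size (card X)) X"
    let ?RB = "random_subset (sample_size (card X))"
    have RA: "finite (set_pmf ?RA)"
      using set_random_subset[OF less.prems] half_size_less[OF X] less.prems by simp
    have A: "finite A" "card A = half_size (card X)" if "A \<in> set_pmf ?RA" for A
      using that set_random_subset[OF less.prems] half_size_less[OF X] less.prems
      by (auto intro: finite_subset)
    have RB: "set_pmf (?RB A) = {B. B \<subseteq> A \<and> card B = sample_size (card X)}"
      if "A \<in> set_pmf ?RA" for A
      using A[OF that] sample_size_le_half_size[OF X] by (intro set_random_subset) auto
    have IH: "finite (set_pmf (sample_minimum arr Y))"
      if "A \<in> set_pmf ?RA" "Y \<subseteq> A" for A Y
    proof (rule less.hyps)
      show "finite Y" using that A(1) finite_subset by blast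
      have "card Y \<le> card A" using that A(1) card_mono by blast
      then show "card Y < card X" using A(2)[OF that(1)] half_size_less[OF X] by simp
    qed
    have D: "fst (below b (A - B)) \<subseteq> A" for b A and B :: "'a set"
      by (auto simp: below_def split: option.splits)
    show ?thesis
      unfolding sample_minimum.simps[of arr X] if_not_P[OF False] set_bind_pmf
        split_beta Let_def set_return_pmf
    proof (intro finite_UN_I)
      show "finite (set_pmf ?RA)" by (rule RA)
      show "finite (set_pmf (?RB A))" if "A \<in> set_pmf ?RA" for A
        using RB[OF that] A(1)[OF that] by simp
      show "finite (set_pmf (sample_minimum arr B))"
        if "A \<in> set_pmf ?RA" "B \<in> set_pmf (?RB A)" for A B
        using that RB[OF that(1)] by (intro IH[of A]) auto
      show "finite (set_pmf (sample_minimum arr (fst (below (snd (fst e)) (A - B)))))"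
        if "A \<in> set_pmf ?RA" for A B and e :: "'a two_smallest \<times> 'a comparisons"
        using that D by (rule IH)
    qed simp
  qed
qed

definition participations :: "'a \<Rightarrow> 'a comparisons \<Rightarrow> nat" where
  "participations m cs = size {#(x, y) \<in># cs. x = m \<or> y = m#}"

end

(*
  Condition on where the minimum m of X falls, with n = |X| and a = |A|; C is the set of
  elements outside A with at most one element of A below them.
  If m lies in B or in A - B, it enters exactly one of the two recursive calls and at most 4,
  respectively 5, further comparisons, one fewer if C is empty.
  If m lies outside A, it is compared with a2 and plays only the tournament of C and the final
  one, which costs at most 7/2 + |C|/2, and 2 less if |C| = 1.
  Since E|C| <= 2(n-a)/(a+1) and P(C = {}) = a(a-1)/(n(n-1)), the bound 9 reproduces itself in
  the induction on |X|: the value of the recursion tends to exactly 9, and the saving in the event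
  that m is in B covers the rounding of n/2.
*)

theory Submission
  imports Defs
begin

section \<open>Tournaments\<close>

text \<open>Bounding the tournament of C by (|C| + 1) / 2 instead of a logarithm makes the cost
  linear in |C|, so its average needs only E|C| and the probabilities of the two special sizes 0 and
  1. Those special sizes are essential. Without them both sides of the case distinction cost about
  5, and E = (E + 5) / 2 + 5 / 2 settles at 10. For m in A, C is empty with probability about 1/2,
  saving 1; for m outside A, |C| = 1 with probability about 1/4, saving 2. Either saving averages
  1/2, and E = (E + 9/2) / 2 + (9/2) / 2 gives 9. The induction hypothesis bounds a recursive call
  by 9 whatever set it receives, so no information on the size of D is required. An obstacle is that
  D and C are cut out by values returned from random calls. Hence correctness of the results comes
  before any cost estimate; it turns D and C into functions of A and B, and since comparisons stay
  inside the input, a call on a set without m costs m nothing.\<close>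

lemma participations_add [simp]:
  "participations m (cs + ds) = participations m cs + participations m ds"
  by (simp add: participations_def)

lemma participations_empty [simp]: "participations m {#} = 0"
  by (simp add: participations_def)

lemma participations_add_mset [simp]:
  "participations m (add_mset (x, y) cs) = of_bool (x = m \<or> y = m) + participations m cs"
  by (simp add: participations_def)

text \<open>Every locality argument below has this form: a procedure whose comparisons stay inside
  its input costs an element outside that input nothing.\<close>

lemma participations_eq_0:
  assumes "set_mset cs \<subseteq> S \<times> S" and "m \<notin> S"
  shows "participations m cs = 0"
  using assms unfolding participations_def by (fastforce simp: filter_mset_eq_conv)

lemma knockout_short: "length xs \<le> 1 \<Longrightarrow> knockout xs = (hd xs, [], {#})"
  by (subst knockout.simps) simp

lemma knockout_long:
  assumes "1 < length xs" and "knockout (take ((length xs + 1) div 2) xs) = (v, ls, cs)"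
    and "knockout (drop ((length xs + 1) div 2) xs) = (w, ms, ds)"
  shows "knockout xs = (if v < w then (v, ls @ [w], cs + ds + {#(v, w)#})
          else (w, ms @ [v], cs + ds + {#(v, w)#}))"
  using assms by (subst knockout.simps) (simp add: Let_def)

text \<open>The clause on \<open>ls\<close> is what makes a second tournament among the losers find
  the second smallest element: an element of the winner's half is dominated by a loser there, one of
  the other half by that half's winner, which has just lost. The containment of \<open>cs\<close>
  keeps the winner's count free of comparisons from the other half.\<close>

lemma knockout_correct:
  assumes "xs \<noteq> []" and "distinct xs" and "knockout xs = (v, ls, cs)"
  shows "v \<in> set xs \<and> (\<forall>x\<in>set xs. v \<le> x) \<and> distinct ls \<and> set ls \<subseteq> set xs - {v} \<and>
    (\<forall>x\<in>set xs - {v}. \<exists>y\<in>set ls. y \<le> x) \<and> set_mset cs \<subseteq> set xs \<times> set xs \<and>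
    (\<forall>k. length xs \<le> 2 ^ k \<longrightarrow> participations v cs \<le> k)"
  using assms
proof (induction xs arbitrary: v ls cs rule: knockout.induct)
  case (1 xs)
  show ?case
  proof (cases "length xs \<le> 1")
    case True
    with 1(3) obtain x where "xs = [x]" by (cases xs) auto
    with 1(5) show ?thesis by (auto simp: knockout_short)
  next
    case False
    define k where "k = (length xs + 1) div 2"
    obtain v' ls' cs' where KL: "knockout (take k xs) = (v', ls', cs')" by (metis prod_cases3)
    obtain w ms ds where KR: "knockout (drop k xs) = (w, ms, ds)" by (metis prod_cases3)
    have k: "0 < k" "k < length xs" using False by (auto simp: k_def)
    have ne: "take k xs \<noteq> []" "drop k xs \<noteq> []" using k by auto
    have set: "set xs = set (take k xs) \<union> set (drop k xs)"
      by (metis append_take_drop_id set_append)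
    have disj: "set (take k xs) \<inter> set (drop k xs) = {}"
      using 1(4) by (metis append_take_drop_id distinct_append)
    have d: "distinct (take k xs)" "distinct (drop k xs)" using 1(4) by auto
    note IHL = 1(1)[OF False k_def ne(1) d(1) KL]
    then have L: "v' \<in> set (take k xs)" "\<forall>x\<in>set (take k xs). v' \<le> x" "distinct ls'"
      "set ls' \<subseteq> set (take k xs) - {v'}"
      "\<forall>x\<in>set (take k xs) - {v'}. \<exists>y\<in>set ls'. y \<le> x"
      "set_mset cs' \<subseteq> set (take k xs) \<times> set (take k xs)"
      "\<And>k'. length (take k xs) \<le> 2 ^ k' \<Longrightarrow> participations v' cs' \<le> k'"
      by blast+
    note IHR = 1(2)[OF False k_def KL[symmetric] refl refl ne(2) d(2) KR]
    then have R: "w \<in> set (drop k xs)" "\<forall>x\<in>set (drop k xs). w \<le> x" "distinct ms"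
      "set ms \<subseteq> set (drop k xs) - {w}"
      "\<forall>x\<in>set (drop k xs) - {w}. \<exists>y\<in>set ms. y \<le> x"
      "set_mset ds \<subseteq> set (drop k xs) \<times> set (drop k xs)"
      "\<And>k'. length (drop k xs) \<le> 2 ^ k' \<Longrightarrow> participations w ds \<le> k'"
      by blast+
    have notin: "v' \<notin> set (drop k xs)" "w \<notin> set (take k xs)"
      using L(1) R(1) disj by blast+
    have res: "(v, ls, cs) = (if v' < w then (v', ls' @ [w], cs' + ds + {#(v', w)#})
          else (w, ms @ [v'], cs' + ds + {#(v', w)#}))"
      using knockout_long[of xs v' ls' cs' w ms ds] 1(5) False KL KR by (simp add: k_def)
    \<comment> \<open>The larger half is rounded up, which is harmless because
      \<open>2 ^ Suc j\<close> is even.\<close>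
    have half: "length (take k xs) \<le> 2 ^ j" "length (drop k xs) \<le> 2 ^ j"
      if "length xs \<le> 2 ^ Suc j" for j
      using that by (auto simp: k_def)
    have part: "participations v cs \<le> j" if j: "length xs \<le> 2 ^ j" for j
    proof (cases j)
      case 0
      with j False show ?thesis by simp
    next
      case (Suc i)
      have "participations v' cs' \<le> i" "participations w ds \<le> i"
        using half[of i] L(7)[of i] R(7)[of i] j Suc by auto
      moreover have "participations v' ds = 0" "participations w cs' = 0"
        using participations_eq_0[OF R(6), of v'] participations_eq_0[OF L(6), of w] notin by auto
      ultimately show ?thesis using res Suc by (auto split: if_splits)
    qed
    have "v' \<noteq> w" using L(1) notin by auto
    have cs: "set_mset cs \<subseteq> set xs \<times> set xs"
    proof -
      have "set_mset cs' \<subseteq> set xs \<times> set xs" "set_mset ds \<subseteq> set xs \<times> set xs"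
        using L(6) R(6) unfolding set by blast+
      then show ?thesis using res L(1) R(1) set by (auto split: if_splits)
    qed
    show ?thesis
    proof (cases "v' < w")
      case True
      with res have r: "v = v'" "ls = ls' @ [w]" by auto
      have "v \<in> set xs" using L(1) r set by simp
      moreover have "\<forall>x\<in>set xs. v \<le> x"
        unfolding set r using L(2) R(2) True by force
      moreover have "distinct ls" using L(3,4) notin(2) r by auto
      moreover have "set ls \<subseteq> set xs - {v}"
        unfolding set r using L(4) R(1) \<open>v' \<noteq> w\<close> by auto
      moreover have "\<forall>x\<in>set xs - {v}. \<exists>y\<in>set ls. y \<le> x"
        unfolding set r using L(5) R(2) by auto
      ultimately show ?thesis using part cs by blast
    next
      case F: False
      with res have r: "v = w" "ls = ms @ [v']" by auto
      have "v \<in> set xs" using R(1) r set by simp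
      moreover have "\<forall>x\<in>set xs. v \<le> x"
        unfolding set r using L(2) R(2) F by force
      moreover have "distinct ls" using R(3,4) notin(1) r by auto
      moreover have "set ls \<subseteq> set xs - {v}"
        unfolding set r using R(4) L(1) \<open>v' \<noteq> w\<close> by auto
      moreover have "\<forall>x\<in>set xs - {v}. \<exists>y\<in>set ls. y \<le> x"
        unfolding set r using R(5) L(2) by auto
      ultimately show ?thesis using part cs by blast
    qed
  qed
qed

section \<open>The two smallest elements\<close>

definition opt_min :: "'a::linorder set \<Rightarrow> 'a option" where
  "opt_min S = (if S = {} then None else Some (Min S))"

text \<open>For empty \<open>S\<close> the unspecified value \<open>Min S\<close> does no harm:
  \<open>S - {Min S}\<close> is again empty, and both entries are \<open>None\<close>.\<close>

definition two_min :: "'a::linorder set \<Rightarrow> 'a two_smallest" where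
  "two_min S = (opt_min S, opt_min (S - {Min S}))"

lemma opt_min_cong:
  assumes "finite S" and "T \<subseteq> S" and "\<And>x. x \<in> S - T \<Longrightarrow> \<exists>y\<in>T. y < x"
  shows "opt_min T = opt_min S"
proof (cases "S = {}")
  case True
  with assms show ?thesis by auto
next
  case False
  with assms have ne: "T \<noteq> {}" by auto
  have T: "finite T" using assms finite_subset by blast
  have "Min S = Min T"
  proof (rule Min_eqI)
    show "Min T \<le> x" if "x \<in> S" for x
    proof (cases "x \<in> T")
      case False
      with that assms(3) obtain y where "y \<in> T" "y < x" by blast
      then show ?thesis using T by (meson Min_le order.trans less_imp_le)
    qed (use T in auto)
  qed (use assms(1,2) Min_in[OF T ne] in auto)
  with False ne show ?thesis by (simp add: opt_min_def)
qed

text \<open>An element with two smaller ones in \<open>T\<close> is neither the smallest nor the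
  second smallest, so leaving it out changes nothing.\<close>

lemma two_min_cong:
  assumes "finite S" and "T \<subseteq> S"
    and below: "\<And>x. x \<in> S - T \<Longrightarrow> \<exists>y\<in>T. \<exists>z\<in>T. y < z \<and> z < x"
  shows "two_min T = two_min S"
proof -
  have 1: "opt_min T = opt_min S"
    using below by (intro opt_min_cong assms) (meson order.strict_trans)
  show ?thesis
  proof (cases "S = {}")
    case True
    with assms show ?thesis by auto
  next
    case False
    have T: "finite T" using assms finite_subset by blast
    have m: "T \<noteq> {}" "Min T = Min S" using 1 False by (auto simp: opt_min_def split: if_splits)
    have "opt_min (T - {Min S}) = opt_min (S - {Min S})"
    proof (rule opt_min_cong)
      fix x assume x: "x \<in> S - {Min S} - (T - {Min S})"
      then obtain y z where "y \<in> T" "z \<in> T" "y < z" "z < x" using below by blast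
      \<comment> \<open>The witness is \<open>z\<close>: from \<open>Min S \<le> y < z\<close> it is
        not the element being removed.\<close>
      moreover have "Min S \<le> y" using m T \<open>y \<in> T\<close> by (metis Min_le)
      ultimately show "\<exists>y\<in>T - {Min S}. y < x" by force
    qed (use assms in auto)
    with 1 m show ?thesis by (simp add: two_min_def)
  qed
qed

lemma two_min_cases:
  assumes "finite S"
  obtains "two_min S = (None, None)"
  | x where "two_min S = (Some x, None)" "x \<in> S"
  | x y where "two_min S = (Some x, Some y)" "x \<in> S" "y \<in> S" "x < y"
proof (cases "S = {}")
  case True
  then show thesis using that(1) by (simp add: two_min_def opt_min_def)
next
  case S: False
  have "Min S \<in> S" using assms S by simp
  show thesis
  proof (cases "S - {Min S} = {}")
    case True
    then have "two_min S = (Some (Min S), None)" using S by (simp add: two_min_def opt_min_def)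
    then show thesis using that(2) \<open>Min S \<in> S\<close> by blast
  next
    case False
    have y: "Min (S - {Min S}) \<in> S - {Min S}" using assms False by (intro Min_in) auto
    then have "Min S < Min (S - {Min S})"
      using assms by (metis DiffE Min_le antisym_conv2 singletonI)
    moreover have "two_min S = (Some (Min S), Some (Min (S - {Min S})))"
      using S False by (simp add: two_min_def opt_min_def)
    ultimately show thesis using that(3) y \<open>Min S \<in> S\<close> by blast
  qed
qed

lemma two_min_in:
  assumes "finite S" and "Some x = fst (two_min S) \<or> Some x = snd (two_min S)"
  shows "x \<in> S"
  by (rule two_min_cases[OF assms(1)]) (use assms(2) in auto)

text \<open>Supplies the hypothesis of \<open>two_min_cong\<close>: for an element that is not
  reported, the reported pair itself provides two smaller ones.\<close>

lemma two_min_beyond: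
  assumes "finite S" and "x \<in> S" and "Some x \<noteq> fst (two_min S)" and "Some x \<noteq> snd (two_min S)"
  obtains p q where "two_min S = (Some p, Some q)" and "p < q" and "q < x"
proof -
  have S: "S \<noteq> {}" using assms by auto
  then have "x \<in> S - {Min S}" using assms by (auto simp: two_min_def opt_min_def)
  with S have ne: "S \<noteq> {}" "S - {Min S} \<noteq> {}" by blast+
  have in2: "Min (S - {Min S}) \<in> S - {Min S}" using assms ne by (intro Min_in) auto
  have "two_min S = (Some (Min S), Some (Min (S - {Min S})))"
    using ne by (simp add: two_min_def opt_min_def)
  moreover have "Min S < Min (S - {Min S})"
    using in2 assms(1) Min_le[of S "Min (S - {Min S})"] by (metis DiffE antisym_conv2 singletonI)
  moreover have "Min (S - {Min S}) < x"
  proof -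
    have "x \<in> S - {Min S}" "x \<noteq> Min (S - {Min S})"
      using assms ne by (auto simp: two_min_def opt_min_def)
    then show ?thesis using assms(1) Min_le[of "S - {Min S}" x] by (simp add: order.not_eq_order_implies_strict)
  qed
  ultimately show thesis by (rule that)
qed

lemma tournament_minimum_correct:
  assumes "distinct xs"
  shows fst_tournament_minimum: "fst (tournament_minimum xs) = two_min (set xs)"
    and tournament_minimum_within: "set_mset (snd (tournament_minimum xs)) \<subseteq> set xs \<times> set xs"
    and participations_tournament_minimum:
      "length xs \<le> 2 ^ k \<Longrightarrow> participations (Min (set xs)) (snd (tournament_minimum xs)) \<le> k"
proof -
  have "fst (tournament_minimum xs) = two_min (set xs) \<and>
    set_mset (snd (tournament_minimum xs)) \<subseteq> set xs \<times> set xs \<and>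
    (\<forall>k. length xs \<le> 2 ^ k \<longrightarrow>
      participations (Min (set xs)) (snd (tournament_minimum xs)) \<le> k)"
  proof (cases "xs = []")
    case True
    then show ?thesis by (simp add: tournament_minimum_def two_min_def opt_min_def)
  next
    case False
    obtain v ls cs where L: "knockout xs = (v, ls, cs)" by (metis prod_cases3)
    note v = knockout_correct[OF False assms L]
    have m: "Min (set xs) = v" using v by (intro Min_eqI) auto
    show ?thesis
    proof (cases "ls = []")
      case True
      with v have "set xs - {v} = {}" by auto
      with False True L v m show ?thesis
        by (simp add: tournament_minimum_def two_min_def opt_min_def)
    next
      case ls: False
      obtain s ms ds where K: "knockout ls = (s, ms, ds)" by (metis prod_cases3)
      have dls: "distinct ls" using v by auto
      note s = knockout_correct[OF ls dls K]
      \<comment> \<open>The winner is not among the elements that lost to it, so the search for the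
        second smallest does not involve it.\<close>
      have 0: "participations v ds = 0" using s v by (intro participations_eq_0[of ds "set ls"]) auto
      have "Min (set xs - {v}) = s"
      proof (intro Min_eqI)
        fix x assume "x \<in> set xs - {v}"
        then obtain y where "y \<in> set ls" "y \<le> x" using v by blast
        with s show "s \<le> x" by force
      qed (use s v in auto)
      moreover have "set xs - {v} \<noteq> {}" using ls v by (cases ls) auto
      ultimately have "fst (tournament_minimum xs) = two_min (set xs)"
        using False ls L K m by (simp add: tournament_minimum_def two_min_def opt_min_def)
      moreover have "snd (tournament_minimum xs) = cs + ds"
        using False ls L K by (simp add: tournament_minimum_def)
      moreover have "set_mset ds \<subseteq> set xs \<times> set xs" using s v by blast
      ultimately show ?thesis using v m 0 by auto
    qed
  qed
  then show "fst (tournament_minimum xs) = two_min (set xs)"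
    and "set_mset (snd (tournament_minimum xs)) \<subseteq> set xs \<times> set xs"
    and "length xs \<le> 2 ^ k \<Longrightarrow> participations (Min (set xs)) (snd (tournament_minimum xs)) \<le> k"
    by auto
qed

text \<open>A list of three is split after its second entry, so the last one skips the first round
  and meets only the winner of the other two.\<close>

lemma participations_last_of_three:
  assumes "z \<noteq> x" and "z \<noteq> y" and "z < min x y"
  shows "participations z (snd (tournament_minimum [x, y, z])) \<le> 1"
  proof -
  have "knockout [x, y] = (min x y, [max x y], {#(x, y)#})"
    using knockout_long[of "[x, y]" x "[]" "{#}" y "[]" "{#}"] by (auto simp: knockout_short)
  then have "knockout [x, y, z] = (z, [min x y], {#(x, y), (min x y, z)#})"
    using knockout_long[of "[x, y, z]" "min x y" "[max x y]" "{#(x, y)#}" z "[]" "{#}"] assms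
    by (auto simp: knockout_short min_def not_less)
  then show ?thesis
    using assms by (auto simp: tournament_minimum_def knockout_short)
qed

lemma set_present: "set (present ys) = {x. Some x \<in> set ys}"
  by (force simp: present_def)

lemma length_present: "length (present ys) \<le> length ys"
  by (simp add: present_def)

lemma distinct_present_two_min:
  assumes "finite S" and "finite T" and "S \<inter> T = {}"
  shows "distinct (present [fst (two_min S), snd (two_min S), fst (two_min T), snd (two_min T)])"
  by (rule two_min_cases[OF assms(1)]; rule two_min_cases[OF assms(2)])
    (use assms(3) in \<open>auto simp: present_def\<close>)

text \<open>An omitted element of \<open>B\<close> or \<open>D\<close> lies beyond both values
  reported there; an element removed by the filter lies above the second value of \<open>B\<close>,
  hence above both. The input is described by \<open>set ys\<close> because the two merges of the
  algorithm list the pairs in opposite orders.\<close>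

lemma two_min_merge:
  assumes "finite S" and "B \<subseteq> S"
    and D: "D = fst (below (snd (two_min B)) (S - B))"
    and ys: "set ys = {fst (two_min D), snd (two_min D), fst (two_min B), snd (two_min B)}"
  shows "two_min (set (present ys)) = two_min S"
proof (rule two_min_cong)
  have fin: "finite B" "finite D" "D \<subseteq> S"
    using assms(1,2) finite_subset[of B S] unfolding D
    by (auto simp: below_def split: option.splits)
  show "finite S" by fact
  show "set (present ys) \<subseteq> S"
  proof
    fix x assume "x \<in> set (present ys)"
    then have "Some x \<in> {fst (two_min D), snd (two_min D), fst (two_min B), snd (two_min B)}"
      unfolding set_present ys by simp
    then show "x \<in> S"
      using two_min_in[OF fin(1), of x] two_min_in[OF fin(2), of x] fin(3) assms(2) by blast
  qed
  fix x assume x: "x \<in> S - set (present ys)"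
  then have n: "Some x \<noteq> fst (two_min D)" "Some x \<noteq> snd (two_min D)"
     "Some x \<noteq> fst (two_min B)" "Some x \<noteq> snd (two_min B)"
    unfolding set_present ys by auto
  have *: "\<exists>y\<in>set (present ys). \<exists>z\<in>set (present ys). y < z \<and> z < x"
    if "two_min B = (Some p, Some q) \<or> two_min D = (Some p, Some q)" "p < q" "q < x" for p q
    using that unfolding set_present ys by fastforce
  show "\<exists>y\<in>set (present ys). \<exists>z\<in>set (present ys). y < z \<and> z < x"
  proof (cases "x \<in> B")
    case True
    from two_min_beyond[OF fin(1) True n(3,4)] show ?thesis using * by metis
  next
    case nB: False
    show ?thesis
    proof (cases "x \<in> D")
      case True
      from two_min_beyond[OF fin(2) True n(1,2)] show ?thesis using * by metis
    next
      case False
      \<comment> \<open>A missing pivot filters nothing out, so here a pivot exists.\<close>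
      with x nB obtain q where q: "snd (two_min B) = Some q" "q \<le> x"
        by (auto simp: D below_def split: option.splits)
      then obtain p where "fst (two_min B) = Some p" "p < q"
        by (cases rule: two_min_cases[OF fin(1)]) auto
      moreover have "q < x" using q n(4) by auto
      ultimately show ?thesis using *[of p q] q by (metis prod.collapse)
    qed
  qed
qed

section \<open>Random subsets\<close>

lemma expectation_random_subset:
  fixes \<phi> :: "'a set \<Rightarrow> real"
  assumes "finite S" and "k \<le> card S"
  shows "real (card S choose k) * measure_pmf.expectation (random_subset k S) \<phi>
    = (\<Sum>T | T \<subseteq> S \<and> card T = k. \<phi> T)"
proof -
  have "finite {T. T \<subseteq> S \<and> card T = k}"
    using assms(1) by (rule rev_finite_subset[OF finite_Pow_iff[THEN iffD2]]) auto
  moreover have "{T. T \<subseteq> S \<and> card T = k} \<noteq> {}"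
    using obtain_subset_with_card_n[OF assms(2)] by blast
  ultimately show ?thesis
    using assms by (simp add: random_subset_def integral_pmf_of_set n_subsets)
qed

lemma subsets_of_card_split:
  assumes "finite S" and "m \<in> S"
  shows "{T. T \<subseteq> S \<and> card T = Suc k} =
    insert m ` {T. T \<subseteq> S - {m} \<and> card T = k} \<union> {T. T \<subseteq> S - {m} \<and> card T = Suc k}"
proof (intro equalityI subsetI)
  fix T assume T: "T \<in> {T. T \<subseteq> S \<and> card T = Suc k}"
  show "T \<in> insert m ` {T. T \<subseteq> S - {m} \<and> card T = k} \<union> {T. T \<subseteq> S - {m} \<and> card T = Suc k}"
  proof (cases "m \<in> T")
    case True
    then have "T = insert m (T - {m})" by auto
    moreover have "card (T - {m}) = k" using T True by simp
    ultimately show ?thesis using T by blast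
  qed (use T in auto)
next
  fix T assume "T \<in> insert m ` {T. T \<subseteq> S - {m} \<and> card T = k} \<union> {T. T \<subseteq> S - {m} \<and> card T = Suc k}"
  then show "T \<in> {T. T \<subseteq> S \<and> card T = Suc k}"
  proof
    assume "T \<in> insert m ` {T. T \<subseteq> S - {m} \<and> card T = k}"
    then obtain U where U: "T = insert m U" "U \<subseteq> S - {m}" "card U = k" by blast
    then have "finite U" "m \<notin> U" using assms(1) finite_subset[of U S] by auto
    with U assms(2) show ?thesis by auto
  qed auto
qed

text \<open>Isolates the cancellation of binomial coefficients: in its use below, the mixture
  weights \<open>a / c\<close> and \<open>b / c\<close> are the ratios \<open>k / n\<close> and
  \<open>l / n\<close>.\<close>

lemma mixture_of_ratios:
  fixes x :: real
  assumes "c * x = a * y + b * z" and "n * a = k * c" and "n * b = l * c" and "c \<noteq> 0"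
  shows "n * x = k * y + l * z"
proof -
  have "c * (n * x) = n * (c * x)" by simp
  also have "\<dots> = (n * a) * y + (n * b) * z" unfolding assms(1) by (simp add: distrib_left)
  also have "\<dots> = c * (k * y + l * z)" unfolding assms(2,3) by (simp add: distrib_left)
  finally show ?thesis using assms(4) by simp
qed

text \<open>
  Conditioning on whether \<open>m\<close> is drawn.  For \<open>k = 0\<close> and for \<open>k = card S\<close> one of the two
  distributions on the right is meaningless, but it has weight \<open>0\<close>.
\<close>

lemma expectation_random_subset_split:
  fixes \<phi> :: "'a set \<Rightarrow> real"
  assumes "finite S" and "m \<in> S" and "k \<le> card S"
  shows "real (card S) * measure_pmf.expectation (random_subset k S) \<phi> =
    real k * measure_pmf.expectation (random_subset (k - 1) (S - {m})) (\<lambda>T. \<phi> (insert m T)) +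
    (real (card S) - real k) * measure_pmf.expectation (random_subset k (S - {m})) \<phi>"
proof -
  define n where "n = card (S - {m})"
  have n: "card S = Suc n" using card_Suc_Diff1[OF assms(1,2)] by (simp add: n_def)
  have fin: "finite (S - {m})" using assms by simp
  have finT: "finite {T. T \<subseteq> S - {m} \<and> P T}" for P
    using fin by (rule rev_finite_subset[OF finite_Pow_iff[THEN iffD2]]) auto
  note E = expectation_random_subset[OF fin, folded n_def]
  let ?E = "measure_pmf.expectation (random_subset k S) \<phi>"
  let ?E1 = "measure_pmf.expectation (random_subset (k - 1) (S - {m})) (\<lambda>T. \<phi> (insert m T))"
  let ?E2 = "measure_pmf.expectation (random_subset k (S - {m})) \<phi>"
  show ?thesis
  proof (cases k)
    case 0
    have "{T. T \<subseteq> S \<and> card T = 0} = {{}}" "{T. T \<subseteq> S - {m} \<and> card T = 0} = {{}}"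
      using assms(1) by (auto dest: finite_subset)
    with 0 show ?thesis by (simp add: random_subset_def n)
  next
    case (Suc j)
    have inj: "inj_on (insert m) {T. T \<subseteq> S - {m} \<and> card T = j}"
    proof (rule inj_onI)
      fix T U assume "T \<in> {T. T \<subseteq> S - {m} \<and> card T = j}" "U \<in> {T. T \<subseteq> S - {m} \<and> card T = j}"
        and eq: "insert m T = insert m U"
      then have "m \<notin> T" "m \<notin> U" by blast+
      with eq show "T = U" by (simp add: insert_ident)
    qed
    have E1: "(n choose j) * ?E1 = (\<Sum>T | T \<subseteq> S - {m} \<and> card T = j. \<phi> (insert m T))"
      unfolding Suc diff_Suc_1
    proof (rule E)
      show "j \<le> n" using assms(3) n Suc by linarith
    qed
    have E2: "(n choose k) * ?E2 = (\<Sum>T | T \<subseteq> S - {m} \<and> card T = k. \<phi> T)"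
    proof (cases "k \<le> n")
      case False
      then have "{T. T \<subseteq> S - {m} \<and> card T = k} = {}"
        using card_mono[OF fin] by (auto simp: n_def)
      with False show ?thesis by (simp only: binomial_eq_0 sum.empty of_nat_0 mult_zero_left not_le)
    qed (rule E)
    have "(\<Sum>T | T \<subseteq> S \<and> card T = k. \<phi> T) =
      (\<Sum>T \<in> insert m ` {T. T \<subseteq> S - {m} \<and> card T = j}. \<phi> T) +
      (\<Sum>T | T \<subseteq> S - {m} \<and> card T = k. \<phi> T)"
      unfolding Suc subsets_of_card_split[OF assms(1,2)]
      by (intro sum.union_disjoint finite_imageI finT) blast
    also have "(\<Sum>T \<in> insert m ` {T. T \<subseteq> S - {m} \<and> card T = j}. \<phi> T) =
      (\<Sum>T | T \<subseteq> S - {m} \<and> card T = j. \<phi> (insert m T))"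
      unfolding sum.reindex[OF inj] comp_def ..
    finally have sum: "(\<Sum>T | T \<subseteq> S \<and> card T = k. \<phi> T) = (n choose j) * ?E1 + (n choose k) * ?E2"
      by (simp only: E1 E2)
    have E: "(Suc n choose k) * ?E = (n choose j) * ?E1 + (n choose k) * ?E2"
      by (rule trans[OF expectation_random_subset[OF assms(1,3), unfolded n] sum])
    \<comment> \<open>The absorption identity; combined with Pascal's rule it yields the
      complementary weight.\<close>
    have a: "real (Suc n) * real (n choose j) = real k * real (Suc n choose k)"
      unfolding of_nat_mult[symmetric] Suc by (simp only: Suc_times_binomial_eq mult.commute[of "Suc j"])
    have b: "real (Suc n) * real (n choose k) = (real (Suc n) - real k) * real (Suc n choose k)"
    proof -
      have "real (Suc n choose k) = real (n choose j) + real (n choose k)"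
        unfolding Suc binomial_Suc_Suc by (rule of_nat_add)
      then have "real (n choose k) = real (Suc n choose k) - real (n choose j)" by linarith
      then show ?thesis using a by (simp only: left_diff_distrib right_diff_distrib)
    qed
    have c: "real (Suc n choose k) \<noteq> 0" using assms(3) n by simp
    show ?thesis
      unfolding n by (rule mixture_of_ratios[OF E a b c])
  qed
qed

lemma finite_set_random_subset:
  assumes "finite S" and "k \<le> card S"
  shows "finite (set_pmf (random_subset k S))"
  using assms by (simp add: set_random_subset)

lemma integrable_random_subset:
  fixes \<phi> :: "'a set \<Rightarrow> real"
  assumes "finite S" and "k \<le> card S"
  shows "integrable (measure_pmf (random_subset k S)) \<phi>"
  using finite_set_random_subset[OF assms] by (rule integrable_measure_pmf_finite)

lemma expectation_random_subset_cong:
  fixes \<phi> \<psi> :: "'a set \<Rightarrow> real"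
  assumes "finite S" and "k \<le> card S"
    and "\<And>T. T \<subseteq> S \<Longrightarrow> card T = k \<Longrightarrow> \<phi> T = \<psi> T"
  shows "measure_pmf.expectation (random_subset k S) \<phi> = measure_pmf.expectation (random_subset k S) \<psi>"
  using assms by (intro integral_cong_AE) (auto simp: AE_measure_pmf_iff set_random_subset)

lemma expectation_of_bool_mem_random_subset:
  assumes "finite S" and "m \<in> S" and "k \<le> card S"
  shows "measure_pmf.expectation (random_subset k S) (\<lambda>T. of_bool (m \<in> T)) = real k / real (card S)"
proof -
  have "(real (card S) - real k) *
      measure_pmf.expectation (random_subset k (S - {m})) (\<lambda>T. of_bool (m \<in> T)) = 0"
  proof (cases "k = card S")
    case False
    have "measure_pmf.expectation (random_subset k (S - {m})) (\<lambda>T. of_bool (m \<in> T) :: real) =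
      measure_pmf.expectation (random_subset k (S - {m})) (\<lambda>T. 0)"
      using assms False by (intro expectation_random_subset_cong) auto
    then show ?thesis by simp
  qed simp
  then have "real (card S) * measure_pmf.expectation (random_subset k S) (\<lambda>T. of_bool (m \<in> T)) = real k"
    using expectation_random_subset_split[OF assms, of "\<lambda>T. of_bool (m \<in> T)"] by simp
  moreover have "card S \<noteq> 0" using assms by auto
  ultimately show ?thesis by (simp add: field_simps)
qed

section \<open>Elements outside a random subset with few drawn elements below them\<close>

definition lower :: "nat \<Rightarrow> 'a::linorder set \<Rightarrow> 'a set \<Rightarrow> 'a set" where
  "lower j S A = {x \<in> S - A. card {y \<in> A. y < x} < j}"

text \<open>The minimum lies below every element left over, so drawing it raises each count by one.
  This recursion is the reason for a general \<open>j\<close>: the case \<open>j = 2\<close> of the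
  algorithm leads to \<open>j = 1\<close> and \<open>j = 0\<close>.\<close>

lemma lower_insert_Min:
  assumes "finite S" and "S \<noteq> {}" and "A \<subseteq> S - {Min S}"
  shows "lower (Suc j) S (insert (Min S) A) = lower j (S - {Min S}) A"
proof -
  have "card {y \<in> insert (Min S) A. y < x} = Suc (card {y \<in> A. y < x})"
    if "x \<in> S - insert (Min S) A" for x
  proof -
    have "Min S < x" using that assms(1) Min_le[of S x] by (auto simp: less_le)
    then have "{y \<in> insert (Min S) A. y < x} = insert (Min S) {y \<in> A. y < x}" by auto
    moreover have "finite {y \<in> A. y < x}" "Min S \<notin> {y \<in> A. y < x}"
      using assms by (auto dest: finite_subset)
    ultimately show ?thesis by simp
  qed
  then show ?thesis by (auto simp: lower_def)
qed

text \<open>An undrawn minimum has nothing drawn below it and always belongs, while the counts of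
  the other elements do not depend on it.\<close>

lemma lower_without_Min:
  assumes "finite S" and "S \<noteq> {}" and "A \<subseteq> S - {Min S}"
  shows "lower (Suc j) S A = insert (Min S) (lower (Suc j) (S - {Min S}) A)"
proof -
  have "{y \<in> A. y < Min S} = {}" using assms by (auto simp: not_less)
  then have "card {y \<in> A. y < Min S} < Suc j" by (simp only: card.empty)
  then have "Min S \<in> lower (Suc j) S A"
    using assms(3) Min_in[OF assms(1,2)] unfolding lower_def by blast
  then show ?thesis using assms(3) by (auto simp: lower_def)
qed

lemma card_lower_without_Min:
  assumes "finite S" and "S \<noteq> {}" and "A \<subseteq> S - {Min S}"
  shows "card (lower (Suc j) S A) = Suc (card (lower (Suc j) (S - {Min S}) A))"
  unfolding lower_without_Min[OF assms] using assms(1) by (subst card_insert_disjoint) (auto simp: lower_def)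

lemma lower_0 [simp]: "lower 0 S A = {}"
  by (simp add: lower_def)

text \<open>The \<open>k\<close> drawn elements leave \<open>k + 1\<close> gaps of expected size
  \<open>(card S - k) / (k + 1)\<close>, and the first \<open>j\<close> of them are collected; for
  \<open>j > k + 1\<close> there are fewer gaps than \<open>j\<close>, whence an inequality. The
  induction conditions on whether the minimum is drawn instead of handling gaps.\<close>

lemma expectation_card_lower:
  assumes "finite S" and "k \<le> card S"
  shows "measure_pmf.expectation (random_subset k S) (\<lambda>A. real (card (lower j S A)))
    \<le> real j * (real (card S) - real k) / (real k + 1)"
  using assms
proof (induction "card S" arbitrary: S j k)
  case 0
  then have "S = {}" by simp
  then show ?case using 0 by (simp add: lower_def)
next
  case (Suc n)
  show ?case
  proof (cases j)
    case 0
    then show ?thesis using Suc.prems by simp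
  next
    case j: (Suc i)
    let ?S = "S - {Min S}"
    have ne: "S \<noteq> {}" using Suc.hyps(2) by auto
    have n: "card ?S = n" "card S = Suc n" "finite ?S"
      using card_Suc_Diff1[OF Suc.prems(1) Min_in[OF Suc.prems(1) ne]] Suc.hyps(2) Suc.prems(1)
    by simp_all
    let ?E1 = "measure_pmf.expectation (random_subset (k - 1) ?S) (\<lambda>A. real (card (lower j S (insert (Min S) A))))"
    let ?E2 = "measure_pmf.expectation (random_subset k ?S) (\<lambda>A. real (card (lower j S A)))"
    have E1: "real k * ?E1 \<le> real i * (real (Suc n) - real k)"
    proof (cases k)
      case (Suc l)
      have l: "l \<le> n" using Suc Suc.prems n by simp
      have "?E1 = measure_pmf.expectation (random_subset l ?S) (\<lambda>A. real (card (lower i ?S A)))"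
        unfolding Suc diff_Suc_1 j using n l Suc.prems(1) ne
        by (intro expectation_random_subset_cong) (auto simp: lower_insert_Min)
      also have "\<dots> \<le> real i * (real n - real l) / (real l + 1)"
        using Suc.hyps(1)[of ?S l i] n l by simp
      finally show ?thesis using Suc by (simp add: field_simps)
    qed (use n in simp)
    have E2: "(real (Suc n) - real k) * ?E2 \<le>
      (real (Suc n) - real k) * (1 + real j * (real n - real k) / (real k + 1))"
    proof (cases "k = Suc n")
      case False
      then have k: "k \<le> n" using Suc.prems n by simp
      have "?E2 = measure_pmf.expectation (random_subset k ?S) (\<lambda>A. 1 + real (card (lower j ?S A)))"
        unfolding j using n k Suc.prems(1) ne
        by (intro expectation_random_subset_cong) (auto simp: card_lower_without_Min)
      also have "\<dots> = 1 + measure_pmf.expectation (random_subset k ?S) (\<lambda>A. real (card (lower j ?S A)))"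
        using n k by (subst Bochner_Integration.integral_add) (auto intro: integrable_random_subset)
      also have "\<dots> \<le> 1 + real j * (real n - real k) / (real k + 1)"
        using Suc.hyps(1)[of ?S k j] n k by simp
      finally show ?thesis using k by (intro mult_left_mono) auto
    qed simp
    have "real (Suc n) * measure_pmf.expectation (random_subset k S) (\<lambda>A. real (card (lower j S A)))
      = real k * ?E1 + (real (Suc n) - real k) * ?E2"
      using expectation_random_subset_split[OF Suc.prems(1) Min_in[OF Suc.prems(1) ne] Suc.prems(2)]
      unfolding n by simp
    also have "\<dots> \<le> real i * (real (Suc n) - real k) +
        (real (Suc n) - real k) * (1 + real j * (real n - real k) / (real k + 1))"
      using E1 E2 by simp
    \<comment> \<open>Since \<open>i + 1 = j\<close>, the factor \<open>j * (Suc n - k)\<close>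
      comes out, leaving \<open>1 + (n - k) / (k + 1) = Suc n / (k + 1)\<close>.\<close>
    also have "\<dots> = real (Suc n) * (real j * (real (Suc n) - real k) / (real k + 1))"
      by (simp add: j divide_simps) (simp add: algebra_simps)
    finally show ?thesis unfolding n(2) by (rule mult_left_le_imp_le) simp
  qed
qed

text \<open>Emptiness forces the minimum to be drawn, since otherwise it belongs to the set itself.
  For \<open>j = 0\<close> the event on the right is certain, which ends the recursion.\<close>

lemma expectation_lower_empty_Suc:
  assumes "finite S" and "S \<noteq> {}" and "0 < k" and "k \<le> card S"
  shows "real (card S) * measure_pmf.expectation (random_subset k S) (\<lambda>A. of_bool (lower (Suc j) S A = {}))
    = real k * measure_pmf.expectation (random_subset (k - 1) (S - {Min S}))
        (\<lambda>A. of_bool (lower j (S - {Min S}) A = {}))"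
proof -
  let ?S = "S - {Min S}"
  have c: "card S = Suc (card ?S)" "finite ?S"
    using card_Suc_Diff1[OF assms(1) Min_in[OF assms(1,2)]] assms(1) by simp_all
  have k: "k - 1 \<le> card ?S" "k \<noteq> card S \<Longrightarrow> k \<le> card ?S" using c(1) assms(4) by linarith+
  have E1: "measure_pmf.expectation (random_subset (k - 1) ?S)
      (\<lambda>A. of_bool (lower (Suc j) S (insert (Min S) A) = {}) :: real)
    = measure_pmf.expectation (random_subset (k - 1) ?S) (\<lambda>A. of_bool (lower j ?S A = {}))"
    using c(2) k(1) by (rule expectation_random_subset_cong) (use assms(1,2) in \<open>simp add: lower_insert_Min\<close>)
  have E2: "(real (card S) - real k) * measure_pmf.expectation (random_subset k ?S)
      (\<lambda>A. of_bool (lower (Suc j) S A = {})) = 0"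
  proof (cases "k = card S")
    case False
    have "measure_pmf.expectation (random_subset k ?S) (\<lambda>A. of_bool (lower (Suc j) S A = {}) :: real)
      = measure_pmf.expectation (random_subset k ?S) (\<lambda>A. 0)"
      using c(2) k(2)[OF False]
      by (rule expectation_random_subset_cong) (use assms(1,2) in \<open>simp add: lower_without_Min\<close>)
    then show ?thesis by simp
  qed simp
  show ?thesis
    using expectation_random_subset_split[OF assms(1) Min_in[OF assms(1,2)] assms(4),
        of "\<lambda>A. of_bool (lower (Suc j) S A = {})"]
    unfolding E1 E2 by simp
qed

text \<open>The event is that the two smallest elements are both drawn; removing them one after the
  other gives the two factors.\<close>

lemma expectation_lower_two_empty:
  assumes "finite S" and "1 < card S" and "0 < k" and "k \<le> card S"
  shows "measure_pmf.expectation (random_subset k S) (\<lambda>A. of_bool (lower 2 S A = {}))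
    = real k * (real k - 1) / (real (card S) * (real (card S) - 1))"
proof -
  let ?S = "S - {Min S}"
  let ?E = "\<lambda>k j S. measure_pmf.expectation (random_subset k S) (\<lambda>A. of_bool (lower j S A = {})) :: real"
  have ne: "S \<noteq> {}" using assms by auto
  have c: "card S = Suc (card ?S)" "finite ?S" "?S \<noteq> {}"
  proof -
    show "card S = Suc (card ?S)"
      using card_Suc_Diff1[OF assms(1) Min_in[OF assms(1) ne]] by simp
    with assms(2) show "?S \<noteq> {}" by force
  qed (use assms in simp)
  have 1: "real (card S) * ?E k 2 S = real k * ?E (k - 1) 1 ?S"
    using expectation_lower_empty_Suc[OF assms(1) ne assms(3,4), of 1] by (simp add: numeral_2_eq_2)
  have 2: "(real (card S) - 1) * ?E (k - 1) 1 ?S = real k - 1"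
  proof (cases "k = 1")
    \<comment> \<open>Once the minimum is drawn nothing more is, and the nonempty rest is left over
      entirely. The recursion asks for a positive size, so this case is separate.\<close>
    case True
    have "?E (k - 1) 1 ?S = measure_pmf.expectation (random_subset (k - 1) ?S) (\<lambda>A. 0)"
    proof (rule expectation_random_subset_cong)
      fix T assume "T \<subseteq> ?S" "card T = k - 1"
      then have "T = {}" using True c(2) by (auto dest: finite_subset)
      then show "of_bool (lower 1 ?S T = {}) = (0::real)" using c(3) by (auto simp: lower_def)
    qed (use c(2) True in simp_all)
    with True show ?thesis by simp
  next
    case False
    have k: "0 < k - 1" "k - 1 \<le> card ?S" using False assms(3,4) c(1) by linarith+
    have "real (card ?S) = real (card S) - 1" "real (k - 1) = real k - 1"
      using c(1) assms(3) by linarith+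
    then show ?thesis
      using expectation_lower_empty_Suc[OF c(2,3) k, of 0] by simp
  qed
  have "(real (card S) * (real (card S) - 1)) * ?E k 2 S
    = (real (card S) - 1) * (real (card S) * ?E k 2 S)" by simp
  also have "\<dots> = real k * (real k - 1)" unfolding 1 using 2 by (metis mult.left_commute)
  finally show ?thesis using assms(2) by (simp add: field_simps)
qed

section \<open>The random sampling algorithm\<close>

text \<open>Counting smaller elements replaces the pivot and covers a missing one as well: if
  \<open>A\<close> has at most one element, no count reaches 2 and nothing is filtered out.\<close>

lemma fst_below_second:
  assumes "finite A"
  shows "fst (below (snd (two_min A)) (X - A)) = lower 2 X A"
proof (rule two_min_cases[OF assms])
  assume e: "two_min A = (None, None)"
  then have "A = {}" by (simp add: two_min_def opt_min_def split: if_splits)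
  then show ?thesis using e by (simp add: below_def lower_def)
next
  fix x assume e: "two_min A = (Some x, None)"
  then have "A \<subseteq> {x}" by (auto simp: two_min_def opt_min_def split: if_splits)
  then have "card {y \<in> A. y < z} < 2" for z
    using card_mono[of "{x}" "{y \<in> A. y < z}"] by fastforce
  then show ?thesis using e by (simp add: below_def lower_def set_diff_eq)
next
  fix x y assume e: "two_min A = (Some x, Some y)" and A: "x \<in> A" "y \<in> A" "x < y"
  have x: "x = Min A" using e by (simp add: two_min_def opt_min_def split: if_splits)
  have "z < y \<longleftrightarrow> card {w \<in> A. w < z} < 2" if "z \<notin> A" for z
  proof
    assume z: "z < y"
    have "{w \<in> A. w < z} \<subseteq> {x}"
    proof
      fix w assume w: "w \<in> {w \<in> A. w < z}"
      show "w \<in> {x}"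
      proof (rule ccontr)
        assume "w \<notin> {x}"
        then have "y \<le> w"
          using w e x assms by (auto simp: two_min_def opt_min_def split: if_splits)
        with w z show False by auto
      qed
    qed
    then show "card {w \<in> A. w < z} < 2"
      using card_mono[of "{x}" "{w \<in> A. w < z}"] by fastforce
  next
    assume c: "card {w \<in> A. w < z} < 2"
    show "z < y"
    proof (rule ccontr)
      assume "\<not> z < y"
      then have "{x, y} \<subseteq> {w \<in> A. w < z}" using A that by (auto simp: not_less le_less)
      then have "card {x, y} \<le> card {w \<in> A. w < z}" using assms by (intro card_mono) auto
      with c A(3) show False by simp
    qed
  qed
  then show ?thesis using e by (auto simp: below_def lower_def)
qed

lemma lower_subset: "lower j S A \<subseteq> S - A"
  by (auto simp: lower_def)

lemma snd_two_min_above: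
  assumes "finite S" and "snd (two_min S) = Some y"
  obtains x where "x \<in> S" and "x < y"
  by (rule two_min_cases[OF assms(1)]) (use assms(2) that in auto)

section \<open>Comparisons made in the steps of one run\<close>

lemma set_snd_below:
  assumes "finite S"
  shows "set_mset (snd (below p S)) \<subseteq> S \<times> set_option p"
  using assms by (auto simp: below_def split: option.splits)

text \<open>Every logged pair contains the pivot, so an element that is not the pivot occurs only in
  its own pair. The pivot would occur in all of them.\<close>

lemma participations_below:
  assumes "finite S" and "p \<noteq> Some m"
  shows "participations m (snd (below p S)) \<le> of_bool (m \<in> S)"
proof (cases p)
  case None
  then show ?thesis by (simp add: below_def)
next
  case (Some b)
  have "participations m (image_mset (\<lambda>x. (x, b)) (mset_set T)) = of_bool (m \<in> T)"
    if "finite T" for T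
    using that
  proof (induction T rule: finite_induct)
    case (insert x T)
    then show ?case using assms(2) Some by auto
  qed simp
  then show ?thesis using Some assms(1) by (simp add: below_def)
qed

lemma participations_tournament_le:
  assumes "distinct xs" and "\<And>x. x \<in> set xs \<Longrightarrow> m \<le> x" and "length xs \<le> 2 ^ k"
  shows "participations m (snd (tournament_minimum xs)) \<le> k"
proof (cases "m \<in> set xs")
  case True
  then have "Min (set xs) = m" using assms(2) by (intro Min_eqI) auto
  then show ?thesis using participations_tournament_minimum[OF assms(1,3)] by simp
next
  case False
  then show ?thesis
    using participations_eq_0[OF tournament_minimum_within[OF assms(1)]] by simp
qed

lemma participations_tournament_eq_0:
  assumes "distinct xs" and "m \<notin> set xs"
  shows "participations m (snd (tournament_minimum xs)) = 0"
  using participations_eq_0[OF tournament_minimum_within[OF assms(1)] assms(2)] .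

lemma arrangement:
  assumes "arrangement arr" and "finite Y"
  shows "distinct (arr Y)" and "set (arr Y) = Y" and "length (arr Y) = card Y"
proof -
  show *: "distinct (arr Y)" "set (arr Y) = Y"
    using assms by (auto simp: arrangement_def)
  show "length (arr Y) = card Y"
    using distinct_card[OF *(1)] *(2) by simp
qed

abbreviation four_of :: "'a::linorder set \<Rightarrow> 'a set \<Rightarrow> 'a list" where
  "four_of S T \<equiv> present [fst (two_min S), snd (two_min S), fst (two_min T), snd (two_min T)]"

lemma set_four_of:
  assumes "finite S" and "finite T"
  shows "set (four_of S T) \<subseteq> S \<union> T"
proof
  fix x assume "x \<in> set (four_of S T)"
  then have "Some x \<in> {fst (two_min S), snd (two_min S), fst (two_min T), snd (two_min T)}"
    unfolding set_present by simp
  then show "x \<in> S \<union> T"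
    using two_min_in[OF assms(1), of x] two_min_in[OF assms(2), of x] by blast
qed

lemma two_min_four_of:
  assumes "finite S" and "B \<subseteq> S"
  shows "two_min (set (four_of (lower 2 S B) B)) = two_min S"
    and "two_min (set (four_of B (lower 2 S B))) = two_min S"
proof -
  have "finite B" using assms finite_subset by blast
  then have D: "lower 2 S B = fst (below (snd (two_min B)) (S - B))"
    by (simp add: fst_below_second)
  show "two_min (set (four_of (lower 2 S B) B)) = two_min S"
    "two_min (set (four_of B (lower 2 S B))) = two_min S"
    by (rule two_min_merge[OF assms D]; auto)+
qed

text \<open>With correct recursive results, the filtered sets and the merged pairs are functions of
  \<open>A\<close> and \<open>B\<close>; only \<open>cmpB\<close> and \<open>cmpD\<close> still
  depend on the random choices inside the calls.\<close>

definition run_comparisons ::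
  "('a::linorder set \<Rightarrow> 'a list) \<Rightarrow> 'a set \<Rightarrow> 'a set \<Rightarrow> 'a set \<Rightarrow>
    'a comparisons \<Rightarrow> 'a comparisons \<Rightarrow> 'a comparisons" where
  "run_comparisons arr X A B cmpB cmpD =
    cmpB + snd (below (snd (two_min B)) (A - B)) + cmpD +
    snd (tournament_minimum (four_of (lower 2 A B) B)) +
    snd (below (snd (two_min A)) (X - A)) +
    snd (tournament_minimum (arr (lower 2 X A))) +
    snd (tournament_minimum (four_of A (lower 2 X A)))"

lemma run_subsets:
  assumes "finite X" and "8 < card X"
    and "A \<in> set_pmf (random_subset (half_size (card X)) X)"
    and "B \<in> set_pmf (random_subset (sample_size (card X)) A)"
  shows "A \<subset> X" and "B \<subset> X" and "B \<subseteq> A" and "lower 2 A B \<subset> X"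
    and "finite A" and "finite B" and "card A = half_size (card X)" and "card B = sample_size (card X)"
proof -
  have A: "A \<subseteq> X" "card A = half_size (card X)"
    using assms(3) half_size_less[OF assms(2)] by (simp_all add: set_random_subset[OF assms(1)])
  show fA: "finite A" using A(1) assms(1) finite_subset by blast
  have le: "sample_size (card X) \<le> card A" using sample_size_le_half_size[OF assms(2)] A(2) by simp
  show B: "B \<subseteq> A" "card B = sample_size (card X)"
    using assms(4) unfolding set_random_subset[OF fA le] by simp_all
  show "A \<subset> X" using A half_size_less[OF assms(2)] by auto
  then show "B \<subset> X" "lower 2 A B \<subset> X" using B lower_subset[of 2 A B] by blast+
  show "finite B" using B fA finite_subset by blast
  show "card A = half_size (card X)" by fact
qed

text \<open>Correctness is assumed for proper subsets only, which makes the equation available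
  within the induction that proves correctness.\<close>

lemma sample_minimum_step:
  assumes fin: "finite X" and arr: "arrangement arr" and large: "8 < card X"
    and correct: "\<forall>Y. Y \<subset> X \<longrightarrow> (\<forall>r\<in>set_pmf (sample_minimum arr Y). fst r = two_min Y)"
  shows "sample_minimum arr X =
    random_subset (half_size (card X)) X \<bind> (\<lambda>A.
    random_subset (sample_size (card X)) A \<bind> (\<lambda>B.
    sample_minimum arr B \<bind> (\<lambda>r.
    sample_minimum arr (lower 2 A B) \<bind> (\<lambda>q.
    return_pmf (two_min X, run_comparisons arr X A B (snd r) (snd q))))))"
proof -
  have "\<not> card X \<le> 8" using large by simp
  show ?thesis
    unfolding sample_minimum.simps[of arr X] if_not_P[OF \<open>\<not> card X \<le> 8\<close>] split_beta Let_def
  proof (intro bind_pmf_cong refl, goal_cases)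
    case (1 A B r)
    note A = 1(1) and B = 1(2) and r = 1(3)
    note AB = run_subsets[OF fin large A B]
    have r: "fst r = two_min B" using correct AB(2) r by blast
    show ?case
      unfolding r fst_below_second[OF AB(6)] ..
  next
    case (2 A B r q)
    note A = 2(1) and B = 2(2) and r = 2(3) and q = 2(4)
    note AB = run_subsets[OF fin large A B]
    have r: "fst r = two_min B" and q: "fst q = two_min (lower 2 A B)"
      using correct AB(2,4) r q by blast+
    let ?C = "lower 2 X A"
    have fD: "finite (lower 2 A B)" and fC: "finite ?C"
      using lower_subset[of 2 A B] lower_subset[of 2 X A] AB(5) fin finite_subset by blast+
    have 1: "fst (tournament_minimum (four_of (lower 2 A B) B)) = two_min A"
      using fst_tournament_minimum[OF distinct_present_two_min[OF fD AB(6)]] lower_subset[of 2 A B]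
        two_min_four_of(1)[OF AB(5,3)] by fastforce
    have 2: "fst (tournament_minimum (arr ?C)) = two_min ?C"
      using fst_tournament_minimum[OF arrangement(1)[OF arr fC]] arrangement(2)[OF arr fC] by simp
    have 3: "fst (tournament_minimum (four_of A ?C)) = two_min X"
      using fst_tournament_minimum[OF distinct_present_two_min[OF AB(5) fC]] lower_subset[of 2 X A]
        two_min_four_of(2)[OF fin, of A] AB(1) by fastforce
    have D: "fst (below (snd (two_min B)) (A - B)) = lower 2 A B"
      "fst (below (snd (two_min A)) (X - A)) = ?C"
      using fst_below_second AB(5,6) by blast+
    show ?case
      unfolding r q 1 D 2 3 run_comparisons_def ..
  qed
qed

lemma run_comparisons_within:
  assumes "finite X" and "arrangement arr" and "A \<subseteq> X" and "B \<subseteq> A"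
    and "set_mset cmpB \<subseteq> B \<times> B" and "set_mset cmpD \<subseteq> lower 2 A B \<times> lower 2 A B"
  shows "set_mset (run_comparisons arr X A B cmpB cmpD) \<subseteq> X \<times> X"
proof -
  let ?C = "lower 2 X A" and ?D = "lower 2 A B"
  have D: "?D \<subseteq> A - B" and C: "?C \<subseteq> X - A" by (rule lower_subset)+
  have fin: "finite A" "finite B" "finite ?D" "finite ?C"
    using assms(1,3,4) D C by (meson finite_subset Diff_subset)+
  have some: "set_option (snd (two_min S)) \<subseteq> S" if "finite S" for S
    using two_min_in[OF that] by (auto simp: eq_commute)
  have "set_mset (snd (below (snd (two_min B)) (A - B))) \<subseteq> X \<times> X"
    "set_mset (snd (below (snd (two_min A)) (X - A))) \<subseteq> X \<times> X"
    using set_snd_below[of "A - B" "snd (two_min B)"] set_snd_below[of "X - A" "snd (two_min A)"]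
      some[OF fin(1)] some[OF fin(2)] assms(1,3,4) fin by blast+
  moreover have "set_mset (snd (tournament_minimum (four_of ?D B))) \<subseteq> X \<times> X"
    using tournament_minimum_within[OF distinct_present_two_min[OF fin(3,2)]] set_four_of[OF fin(3,2)]
      D assms(3,4) by blast
  moreover have "set_mset (snd (tournament_minimum (arr ?C))) \<subseteq> X \<times> X"
    using tournament_minimum_within[OF arrangement(1)[OF assms(2) fin(4)]]
      arrangement(2)[OF assms(2) fin(4)] C by blast
  moreover have "set_mset (snd (tournament_minimum (four_of A ?C))) \<subseteq> X \<times> X"
    using tournament_minimum_within[OF distinct_present_two_min[OF fin(1,4)]] set_four_of[OF fin(1,4)]
      C assms(3) by blast
  moreover have "set_mset cmpB \<subseteq> X \<times> X" "set_mset cmpD \<subseteq> X \<times> X"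
    using assms(3-6) D by blast+
  ultimately show ?thesis by (simp add: run_comparisons_def)
qed

text \<open>Locality of the comparisons rests on the description of a run, and that rests on correct
  results for smaller sets, so one induction carries both claims.\<close>

lemma sample_minimum_correct:
  assumes "finite X" and "arrangement arr" and "r \<in> set_pmf (sample_minimum arr X)"
  shows "fst r = two_min X \<and> set_mset (snd r) \<subseteq> X \<times> X"
  using assms(1,3)
proof (induction "card X" arbitrary: X r rule: less_induct)
  case less
  show ?case
  proof (cases "card X \<le> 8")
    case True
    then have "r = tournament_minimum (arr X)"
      using less.prems(2) by (simp add: sample_minimum.simps[of arr X])
    then show ?thesis
      using fst_tournament_minimum tournament_minimum_within arrangement[OF assms(2) less.prems(1)]
      by metis
  next
    case False
    then have large: "8 < card X" by simp
    have IH: "fst r = two_min Y" "set_mset (snd r) \<subseteq> Y \<times> Y"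
      if "Y \<subset> X" "r \<in> set_pmf (sample_minimum arr Y)" for Y r
      using less.hyps[OF psubset_card_mono[OF less.prems(1) that(1)] _ that(2)] that(1) less.prems(1)
        finite_subset[of Y X] by auto
    have "\<forall>Y. Y \<subset> X \<longrightarrow> (\<forall>r\<in>set_pmf (sample_minimum arr Y). fst r = two_min Y)"
      using IH(1) by blast
    note step = sample_minimum_step[OF less.prems(1) assms(2) large this]
    from less.prems(2) obtain A B s q where
      A: "A \<in> set_pmf (random_subset (half_size (card X)) X)"
      and B: "B \<in> set_pmf (random_subset (sample_size (card X)) A)"
      and s: "s \<in> set_pmf (sample_minimum arr B)"
      and q: "q \<in> set_pmf (sample_minimum arr (lower 2 A B))"
      and r: "r = (two_min X, run_comparisons arr X A B (snd s) (snd q))"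
      unfolding step by auto
    note AB = run_subsets[OF less.prems(1) large A B]
    show ?thesis
      using run_comparisons_within[OF less.prems(1) assms(2) _ AB(3) IH(2)[OF AB(2) s] IH(2)[OF AB(4) q]]
        AB(1) r by auto
  qed
qed

section \<open>Expected cost\<close>

text \<open>A linear substitute for the rounded-up logarithm. It is exact for \<open>c\<close> equal
  to 2, 3 and 4; the excess at \<open>c = 1\<close> is recovered by treating |C| = 1
  separately.\<close>

lemma le_two_power_half: "c \<le> 2 ^ ((c + 1) div 2)"
proof (cases "c = 0")
  case False
  then obtain k where k: "(c + 1) div 2 = Suc k" by (cases "(c + 1) div 2") auto
  then have "c \<le> 2 * Suc k" by presburger
  also have "\<dots> \<le> 2 * 2 ^ k" by (intro mult_left_mono Suc_leI less_exp) simp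
  finally show ?thesis using k by simp
qed simp

text \<open>The pair of \<open>A\<close> comes first in \<open>four_of\<close>, so \<open>m\<close>
  is the last of at most three entries and enters only in the final round.\<close>

lemma participations_two_and_singleton:
  assumes "finite A" and "m \<notin> A" and "\<And>x. x \<in> A \<Longrightarrow> m \<le> x"
  shows "participations m (snd (tournament_minimum (four_of A {m}))) \<le> 1"
proof -
  have m: "two_min {m} = (Some m, None)" by (simp add: two_min_def opt_min_def)
  show ?thesis
  proof (rule two_min_cases[OF assms(1)])
    fix x y assume "two_min A = (Some x, Some y)" "x \<in> A" "y \<in> A" "x < y"
    moreover have "m < x" "m < y" using calculation assms by (auto simp: less_le)
    ultimately show ?thesis
      using participations_last_of_three[of m x y] m by (simp add: present_def)
  next
    fix x assume x: "two_min A = (Some x, None)" "x \<in> A"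
    then have "m < x" using assms by (auto simp: less_le)
    then have "participations m (snd (tournament_minimum [x, m])) \<le> 1"
      by (intro participations_tournament_le) auto
    with x show ?thesis using m by (simp add: present_def)
  next
    assume "two_min A = (None, None)"
    then show ?thesis
      using participations_tournament_le[of "[m]" m 0] m by (simp add: present_def)
  qed
qed

text \<open>Cost to the minimum outside the recursive calls. Inside \<open>A\<close>: 1 for the
  pivot \<open>b2\<close> and 2 in each tournament of four; if C is empty, the final one has at most
  two entries. Outside \<open>A\<close>: 1 for \<open>a2\<close>, at most (|C| + 1) / 2 in C and 2
  at the end; for |C| = 1 this would be 4, but C needs no comparison and the end only one. The
  comparison with \<open>b2\<close> is charged even for a minimum in \<open>B\<close>; the
  \<open>- 1\<close> in \<open>participations_run_comparisons\<close> refunds it.\<close>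

definition run_cost :: "'a::linorder set \<Rightarrow> 'a set \<Rightarrow> real" where
  "run_cost X A =
    (if Min X \<in> A then 5 - of_bool (lower 2 X A = {})
     else 7 / 2 + real (card (lower 2 X A)) / 2 - 2 * of_bool (card (lower 2 X A) = 1))"

lemma participations_run_comparisons:
  assumes fin: "finite X" and ne: "X \<noteq> {}" and arr: "arrangement arr"
    and A: "A \<subseteq> X" and B: "B \<subseteq> A"
    and cmpB: "set_mset cmpB \<subseteq> B \<times> B" and cmpD: "set_mset cmpD \<subseteq> lower 2 A B \<times> lower 2 A B"
  shows "real (participations (Min X) (run_comparisons arr X A B cmpB cmpD)) \<le>
    (if Min X \<in> B then real (participations (Min X) cmpB) - 1
     else if Min X \<in> A then real (participations (Min X) cmpD) else 0) + run_cost X A"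
proof -
  define m where "m = Min X"
  let ?C = "lower 2 X A" and ?D = "lower 2 A B"
  have D: "?D \<subseteq> A - B" and C: "?C \<subseteq> X - A" by (rule lower_subset)+
  have finA: "finite A" "finite B" "finite ?D" "finite ?C"
    using fin A B D C by (meson finite_subset Diff_subset)+
  have m: "m \<in> X" "\<And>x. x \<in> X \<Longrightarrow> m \<le> x" using fin ne by (auto simp: m_def)
  \<comment> \<open>The minimum of \<open>X\<close> is never a second smallest element, hence never
    a pivot.\<close>
  have not_second: "snd (two_min S) \<noteq> Some m" if "S \<subseteq> X" "finite S" for S
    using snd_two_min_above[OF that(2), of m] that(1) m(2) by (metis leD subsetD)
  have AX: "set (four_of ?D B) \<subseteq> A" "set (four_of A ?C) \<subseteq> X"
    using set_four_of[OF finA(3,2)] set_four_of[OF finA(1,4)] A B C D by blast+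
  note dist = distinct_present_two_min[OF finA(3,2)] distinct_present_two_min[OF finA(1,4)]
  have dist: "distinct (four_of ?D B)" "distinct (four_of A ?C)"
    using dist D C by blast+
  define p1 where "p1 = participations m (snd (below (snd (two_min B)) (A - B)))"
  define p2 where "p2 = participations m (snd (tournament_minimum (four_of ?D B)))"
  define p3 where "p3 = participations m (snd (below (snd (two_min A)) (X - A)))"
  define p4 where "p4 = participations m (snd (tournament_minimum (arr ?C)))"
  define p5 where "p5 = participations m (snd (tournament_minimum (four_of A ?C)))"
  have total: "participations m (run_comparisons arr X A B cmpB cmpD) =
      participations m cmpB + p1 + participations m cmpD + p2 + p3 + p4 + p5"
    by (simp add: run_comparisons_def p1_def p2_def p3_def p4_def p5_def)
  have p1: "p1 \<le> of_bool (m \<in> A - B)"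
    unfolding p1_def using finA A B not_second[of B] by (intro participations_below) auto
  have p3: "p3 \<le> of_bool (m \<in> X - A)"
    unfolding p3_def using fin finA A not_second[of A] by (intro participations_below) auto
  have p2: "p2 \<le> 2"
    unfolding p2_def
  proof (rule participations_tournament_le[OF dist(1)])
    show "length (four_of ?D B) \<le> 2 ^ 2" by (rule order.trans[OF length_present]) simp
  qed (use AX(1) A m(2) in blast)
  have p5: "p5 \<le> 2"
    unfolding p5_def
  proof (rule participations_tournament_le[OF dist(2)])
    show "length (four_of A ?C) \<le> 2 ^ 2" by (rule order.trans[OF length_present]) simp
  qed (use AX(2) m(2) in blast)
  have B0: "participations m cmpB = 0" if "m \<notin> B"
    using participations_eq_0[OF cmpB that] .
  have D0: "participations m cmpD = 0" if "m \<notin> A - B"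
    using participations_eq_0[OF cmpD] that D by blast
  show ?thesis
  proof (cases "m \<in> A")
    case True
    have "m \<notin> ?C" using True C by blast
    then have p4: "p4 = 0"
      unfolding p4_def using arrangement[OF arr finA(4)] by (intro participations_tournament_eq_0) auto
    have p5': "p5 \<le> 1" if "?C = {}"
      unfolding p5_def
    proof (rule participations_tournament_le[OF dist(2)])
      have "two_min ({} :: 'a set) = (None, None)" by (simp add: two_min_def opt_min_def)
      then have "four_of A ?C = present [fst (two_min A), snd (two_min A)]"
        using that by (simp add: present_def)
      then show "length (four_of A ?C) \<le> 2 ^ 1"
        using length_present[of "[fst (two_min A), snd (two_min A)]"] by simp
    qed (use AX(2) m(2) in blast)
    show ?thesis
      using total p1 p2 p3 p4 p5 p5' B0 D0 True
      unfolding m_def[symmetric] run_cost_def by (cases "m \<in> B"; cases "?C = {}") simp_all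
  next
    case False
    then have nB: "m \<notin> B" "m \<notin> A - B" using B by blast+
    have "m \<notin> set (four_of ?D B)" using False AX(1) by blast
    then have p2: "p2 = 0"
      unfolding p2_def by (rule participations_tournament_eq_0[OF dist(1)])
    have p1: "p1 = 0" using p1 nB by simp
    have p3: "p3 \<le> 1" by (rule order.trans[OF p3]) simp
    have mC: "m \<in> ?C"
    proof -
      have "{y \<in> A. y < m} = {}" using A m(2) by (auto simp: not_less)
      then have "card {y \<in> A. y < m} < 2" by (simp only: card.empty)
      then show ?thesis using False m(1) by (simp add: lower_def)
    qed
    have p4_le: "p4 \<le> k" if "card ?C \<le> 2 ^ k" for k
      unfolding p4_def
      using arrangement[OF arr finA(4)] that C m(2) by (intro participations_tournament_le) auto
    have p45: "real p4 + real p5 \<le> 5 / 2 + real (card ?C) / 2 - 2 * of_bool (card ?C = 1)"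
    proof (cases "card ?C = 1")
      case True
      then have Cm: "?C = {m}" using mC by (metis card_1_singletonE singletonD)
      have "p5 \<le> 1"
        unfolding p5_def Cm using finA(1) False A m(2) by (intro participations_two_and_singleton) auto
      moreover have "p4 = 0" using p4_le[of 0] True by simp
      ultimately show ?thesis using True by simp
    next
      case False
      have "p4 \<le> (card ?C + 1) div 2" by (intro p4_le le_two_power_half)
      then have "2 * p4 \<le> card ?C + 1" by linarith
      then show ?thesis using p5 False by simp
    qed
    show ?thesis
      using total p1 p2 p3 p45 B0[OF nB(1)] D0[OF nB(2)] False nB
      unfolding m_def[symmetric] run_cost_def by simp
  qed
qed

section \<open>Averaging over the random choices\<close>

lemma expectation_bind_pmf_le:
  fixes h :: "'b \<Rightarrow> real"
  assumes "finite (set_pmf p)" and "\<And>x. x \<in> set_pmf p \<Longrightarrow> finite (set_pmf (f x))"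
    and "\<And>x. x \<in> set_pmf p \<Longrightarrow> measure_pmf.expectation (f x) h \<le> g x"
  shows "measure_pmf.expectation (p \<bind> f) h \<le> measure_pmf.expectation p g"
proof -
  have "measure_pmf.expectation (p \<bind> f) h =
      (\<Sum>x\<in>set_pmf p. pmf p x * measure_pmf.expectation (f x) h)"
    by (subst pmf_expectation_bind[OF assms(1)]) (auto intro: assms(2))
  also have "\<dots> \<le> (\<Sum>x\<in>set_pmf p. pmf p x * g x)"
    using assms(3) by (intro sum_mono mult_left_mono) auto
  also have "\<dots> = measure_pmf.expectation p g"
    by (subst integral_measure_pmf[OF assms(1)]) auto
  finally show ?thesis .
qed

lemma expectation_pmf_mono:
  fixes f g :: "'b \<Rightarrow> real"
  assumes "finite (set_pmf p)" and "\<And>x. x \<in> set_pmf p \<Longrightarrow> f x \<le> g x"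
  shows "measure_pmf.expectation p f \<le> measure_pmf.expectation p g"
  using assms by (intro integral_mono_AE integrable_measure_pmf_finite) (auto simp: AE_measure_pmf_iff)

text \<open>From \<open>8 powr (2/3) = 4\<close>. This much saving is what the odd case of
  \<open>expected_cost_bound\<close> consumes.\<close>

lemma sample_size_ge_4:
  assumes "8 < n"
  shows "4 \<le> sample_size n"
proof -
  have "(8::real) = 2 powr 3" by simp
  then have "(8::real) powr (2/3) = 2 powr 2" by (simp only: powr_powr) simp
  then have "(4::real) = 8 powr (2/3)" by simp
  also have "\<dots> \<le> real n powr (2/3)" using assms by (intro powr_mono2) auto
  finally show ?thesis unfolding sample_size_def by linarith
qed

lemma half_size_cases:
  obtains "n = 2 * half_size n" | "n + 1 = 2 * half_size n"
  unfolding half_size_def by linarith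

text \<open>The averaged recursion multiplied by \<open>n\<close>, with
  \<open>(9 - s / a + 5) * a = 14 * a - s\<close>. For even \<open>n\<close> the two savings add up
  to exactly \<open>a\<close>, leaving at most \<open>18 * a - s = 9 * n - s\<close>. For odd
  \<open>n\<close> the bound is \<open>18 * a - 5 - s\<close> against
  \<open>9 * n = 18 * a - 9\<close>, which uses up \<open>4 \<le> s\<close>.\<close>

lemma expected_cost_bound:
  fixes a n s :: real
  assumes "n = 2 * a \<or> n + 1 = 2 * a" and "5 \<le> a" and "4 \<le> s"
  shows "14 * a - s - a * (a - 1) / (n - 1) +
    (n - a) * (4 + (n - 1 - a) / (a + 1) - 2 * (a * (a - 1) / ((n - 1) * (n - 2)))) \<le> 9 * n"
  using assms(1)
proof
  assume n: "n = 2 * a"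
  have 1: "2 * (a * (a - 1) / ((n - 1) * (n - 2))) = a / (2 * a - 1)"
    using assms(2) by (simp add: n divide_simps)
  have 2: "a * (a - 1) / (n - 1) + a * (a / (2 * a - 1)) = a"
    using assms(2) by (simp add: n divide_simps) (simp add: algebra_simps)
  have 3: "(n - 1 - a) / (a + 1) \<le> 1" using assms(2) by (simp add: n)
  then have "a * ((n - 1 - a) / (a + 1)) \<le> a * 1" using assms(2) by (intro mult_left_mono) auto
  then show ?thesis using assms(3) 2 unfolding 1 by (simp add: n algebra_simps)
next
  assume "n + 1 = 2 * a"
  then have n: "n = 2 * a - 1" by simp
  have 1: "2 * (a * (a - 1) / ((n - 1) * (n - 2))) = a / (2 * a - 3)"
    using assms(2) by (simp add: n divide_simps)
  have 2: "a * (a - 1) / (n - 1) = a / 2"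
    using assms(2) by (simp add: n divide_simps)
  have 3: "1 / 2 \<le> a / (2 * a - 3)" using assms(2) by (simp add: divide_simps)
  have 4: "(n - 1 - a) / (a + 1) = 1 - 3 / (a + 1)"
    using assms(2) by (simp add: n divide_simps)
  have "(n - a) * (4 + (n - 1 - a) / (a + 1) - a / (2 * a - 3)) \<le> (n - a) * (9 / 2 - 3 / (a + 1))"
  proof (rule mult_left_mono)
    show "4 + (n - 1 - a) / (a + 1) - a / (2 * a - 3) \<le> 9 / 2 - 3 / (a + 1)" using 3 4 by linarith
  qed (use assms(2) n in simp)
  \<comment> \<open>At least 1/2 of \<open>3 * (a - 1) / (a + 1)\<close> must be kept: dropping it
    all would call for \<open>s \<ge> 9 / 2\<close>.\<close>
  also have "\<dots> \<le> (a - 1) * (9 / 2) - 1 / 2"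
    using assms(2) by (simp add: n divide_simps) (simp add: algebra_simps)
  finally have le: "(n - a) * (4 + (n - 1 - a) / (a + 1) - a / (2 * a - 3)) \<le> (a - 1) * (9 / 2) - 1 / 2" .
  have "14 * a - s - a / 2 + p \<le> 9 * n" if "p \<le> (a - 1) * (9 / 2) - 1 / 2" for p
    using that assms(3) n by (simp add: field_simps)
  from this[OF le] show ?thesis unfolding 1 2 .
qed

text \<open>Whichever call receives the minimum contributes at most 9, and 1 is refunded if that
  call is the one on \<open>B\<close>. Given that the minimum is in \<open>A\<close>, this refund
  has probability \<open>sample_size (card X) / half_size (card X)\<close>.\<close>

lemma expectation_sample_minimum_le:
  assumes fin: "finite X" and arr: "arrangement arr" and large: "8 < card X"
    and IH: "\<And>Y. Y \<subset> X \<Longrightarrow> measure_pmf.expectation (sample_minimum arr Y)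
           (\<lambda>(res, cs). real (participations (Min Y) cs)) \<le> 9"
  shows "measure_pmf.expectation (sample_minimum arr X) (\<lambda>(res, cs). real (participations (Min X) cs))
    \<le> measure_pmf.expectation (random_subset (half_size (card X)) X)
        (\<lambda>A. (if Min X \<in> A then 9 - real (sample_size (card X)) / real (half_size (card X)) else 0)
          + run_cost X A)"
proof -
  define m where "m = Min X"
  define h :: "'a two_smallest \<times> 'a comparisons \<Rightarrow> real"
    where "h = (\<lambda>(res, cs). real (participations m cs))"
  have ne: "X \<noteq> {}" using large by auto
  have m: "m \<in> X" "\<And>x. x \<in> X \<Longrightarrow> m \<le> x" using fin ne by (auto simp: m_def)
  have Min_eq: "Min Y = m" if "Y \<subset> X" "m \<in> Y" for Y
    using that m(2) finite_subset[of Y X] fin by (intro Min_eqI) auto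
  have correct: "\<forall>Y. Y \<subset> X \<longrightarrow> (\<forall>r\<in>set_pmf (sample_minimum arr Y). fst r = two_min Y)"
    using sample_minimum_correct[OF _ arr] fin finite_subset by blast
  note step = sample_minimum_step[OF fin arr large correct]
  let ?RA = "random_subset (half_size (card X)) X"
  let ?RB = "\<lambda>A. random_subset (sample_size (card X)) A"
  let ?run = "\<lambda>A B. sample_minimum arr B \<bind> (\<lambda>r. sample_minimum arr (lower 2 A B) \<bind>
    (\<lambda>q. return_pmf (two_min X, run_comparisons arr X A B (snd r) (snd q))))"
  have finRA: "finite (set_pmf ?RA)"
    using half_size_less[OF large] by (intro finite_set_random_subset fin) simp
  have finRB: "finite (set_pmf (?RB A))" if "A \<in> set_pmf ?RA" for A
  proof -
    have "finite A" "card A = half_size (card X)"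
      using that half_size_less[OF large] finite_subset[of A X] fin
      by (simp_all add: set_random_subset[OF fin])
    then show ?thesis using sample_size_le_half_size[OF large] by (intro finite_set_random_subset) auto
  qed
  have finY: "finite (set_pmf (sample_minimum arr Y))" if "Y \<subset> X" for Y
    using that fin finite_subset[of Y X] by (intro finite_set_sample_minimum) auto
  have run: "measure_pmf.expectation (?run A B) h \<le>
      ((if m \<in> A then 9 else 0) - of_bool (m \<in> B)) + run_cost X A"
    if A: "A \<in> set_pmf ?RA" and B: "B \<in> set_pmf (?RB A)" for A B
  proof -
    note AB = run_subsets[OF fin large A B]
    let ?D = "lower 2 A B"
    let ?b = "\<lambda>r q. (if m \<in> B then real (participations m (snd r)) - 1
        else if m \<in> A then real (participations m (snd q)) else 0) + run_cost X A"
    have within: "set_mset (snd r) \<subseteq> Y \<times> Y"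
      if "Y \<subset> X" "r \<in> set_pmf (sample_minimum arr Y)" for Y r
      using sample_minimum_correct[OF _ arr that(2)] that(1) fin finite_subset[of Y X] by auto
    have E: "measure_pmf.expectation (sample_minimum arr Y) (\<lambda>r. real (participations m (snd r))) \<le> 9"
      if "Y \<subset> X" "m \<in> Y" for Y
      using IH[OF that(1)] unfolding Min_eq[OF that] split_beta .
    have int: "integrable (measure_pmf (sample_minimum arr Y)) f" if "Y \<subset> X"
      for Y and f :: "'a two_smallest \<times> 'a comparisons \<Rightarrow> real"
      using finY[OF that] by (rule integrable_measure_pmf_finite)
    have "measure_pmf.expectation (?run A B) h \<le> measure_pmf.expectation (sample_minimum arr B)
        (\<lambda>r. measure_pmf.expectation (sample_minimum arr ?D) (?b r))"
    proof (intro expectation_bind_pmf_le finY AB(2,4))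
      fix r q assume r: "r \<in> set_pmf (sample_minimum arr B)"
        and q: "q \<in> set_pmf (sample_minimum arr ?D)"
      show "measure_pmf.expectation (return_pmf (two_min X, run_comparisons arr X A B (snd r) (snd q))) h
          \<le> ?b r q"
        using participations_run_comparisons[OF fin ne arr psubset_imp_subset[OF AB(1)] AB(3)
            within[OF AB(2) r] within[OF AB(4) q]]
        by (simp only: expectation_return_pmf h_def prod.case m_def)
    qed (use finY[OF AB(4)] in auto)
    also have "\<dots> \<le> ((if m \<in> A then 9 else 0) - of_bool (m \<in> B)) + run_cost X A"
    proof (cases "m \<in> B")
      case True
      then have "m \<in> A" using AB(3) by blast
      have "measure_pmf.expectation (sample_minimum arr B)
          (\<lambda>r. real (participations m (snd r)) + (run_cost X A - 1)) \<le> 9 + (run_cost X A - 1)"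
        using E[OF AB(2) True] int[OF AB(2)] by (subst Bochner_Integration.integral_add) auto
      with True \<open>m \<in> A\<close> show ?thesis by (simp add: algebra_simps)
    next
      case mB: False
      show ?thesis
      proof (cases "m \<in> A")
        case True
        \<comment> \<open>The minimum passes the filter, so outside \<open>B\<close> it enters the
          second call.\<close>
        have "{y \<in> B. y < m} = {}" using AB(2) m(2) by (auto simp: not_less)
        then have "card {y \<in> B. y < m} < 2" by (simp only: card.empty)
        then have "m \<in> ?D" using True mB by (simp add: lower_def)
        then have "measure_pmf.expectation (sample_minimum arr ?D)
            (\<lambda>q. real (participations m (snd q)) + run_cost X A) \<le> 9 + run_cost X A"
          using E[OF AB(4)] int[OF AB(4)] by (subst Bochner_Integration.integral_add) auto
        with True mB show ?thesis by simp
      next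
        case False
        with mB show ?thesis by simp
      qed
    qed
    finally show ?thesis .
  qed
  have "measure_pmf.expectation (sample_minimum arr X) h \<le> measure_pmf.expectation ?RA
      (\<lambda>A. measure_pmf.expectation (?RB A)
        (\<lambda>B. ((if m \<in> A then 9 else 0) - of_bool (m \<in> B)) + run_cost X A))"
    unfolding step
  proof (rule expectation_bind_pmf_le[OF finRA])
    fix A assume A: "A \<in> set_pmf ?RA"
    have finrun: "finite (set_pmf (?run A B))" if B: "B \<in> set_pmf (?RB A)" for B
      using finY run_subsets(2,4)[OF fin large A B] by simp
    show "finite (set_pmf (?RB A \<bind> ?run A))"
      using finRB[OF A] finrun by simp
    show "measure_pmf.expectation (?RB A \<bind> ?run A) h \<le> measure_pmf.expectation (?RB A)
        (\<lambda>B. ((if m \<in> A then 9 else 0) - of_bool (m \<in> B)) + run_cost X A)"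
      using finRB[OF A] finrun run[OF A] by (intro expectation_bind_pmf_le)
  qed
  also have "\<dots> \<le> measure_pmf.expectation ?RA
        (\<lambda>A. (if m \<in> A then 9 - real (sample_size (card X)) / real (half_size (card X)) else 0)
          + run_cost X A)"
  proof (rule expectation_pmf_mono[OF finRA])
    fix A assume A: "A \<in> set_pmf ?RA"
    have fA: "finite A" "card A = half_size (card X)"
      using A half_size_less[OF large] finite_subset[of A X] fin
      by (simp_all add: set_random_subset[OF fin])
    have s: "sample_size (card X) \<le> card A" using sample_size_le_half_size[OF large] fA by simp
    have "measure_pmf.expectation (?RB A) (\<lambda>B. of_bool (m \<in> B) :: real) =
        (if m \<in> A then real (sample_size (card X)) / real (half_size (card X)) else 0)"
    proof (cases "m \<in> A")
      case True
      then show ?thesis using expectation_of_bool_mem_random_subset[OF fA(1) _ s] fA by simp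
    next
      case False
      have "measure_pmf.expectation (?RB A) (\<lambda>B. of_bool (m \<in> B) :: real) =
          measure_pmf.expectation (?RB A) (\<lambda>B. 0)"
        by (rule expectation_random_subset_cong[OF fA(1) s]) (use False in auto)
      with False show ?thesis by simp
    qed
    moreover have "measure_pmf.expectation (?RB A)
        (\<lambda>B. ((if m \<in> A then 9 else 0) + run_cost X A) - of_bool (m \<in> B)) =
        ((if m \<in> A then 9 else 0) + run_cost X A) - measure_pmf.expectation (?RB A) (\<lambda>B. of_bool (m \<in> B))"
      using integrable_random_subset[OF fA(1) s] by (subst Bochner_Integration.integral_diff) auto
    ultimately show "measure_pmf.expectation (?RB A)
        (\<lambda>B. ((if m \<in> A then 9 else 0) - of_bool (m \<in> B)) + run_cost X A)
      \<le> (if m \<in> A then 9 - real (sample_size (card X)) / real (half_size (card X)) else 0) + run_cost X A"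
      by (simp add: algebra_simps split: if_splits)
  qed
  finally show ?thesis unfolding h_def m_def .
qed

text \<open>Here \<open>c\<close> is the share of the recursive calls. For the minimum in
  \<open>A\<close>, C is empty if the second smallest element is drawn too, with conditional
  probability \<open>(a - 1) / (n - 1)\<close>. Otherwise the minimum itself lies in C, which turns
  7/2 into 4 and makes |C| = 1 the event that nothing else is in C.\<close>

lemma expectation_run_cost_le:
  fixes X :: "'a::linorder set"
  assumes fin: "finite X" and a: "5 \<le> a" "a < card X"
  shows "real (card X) * measure_pmf.expectation (random_subset a X)
      (\<lambda>A. (if Min X \<in> A then c else 0) + run_cost X A)
    \<le> (c + 5) * real a - real a * (real a - 1) / (real (card X) - 1) +
      (real (card X) - real a) * (4 + (real (card X) - 1 - real a) / (real a + 1) -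
        2 * (real a * (real a - 1) / ((real (card X) - 1) * (real (card X) - 2))))"
proof -
  let ?Y = "X - {Min X}"
  define n where "n = real (card X)"
  have ne: "X \<noteq> {}" using a by auto
  have mX: "Min X \<in> X" using fin ne by simp
  have Y: "finite ?Y" "real (card ?Y) = n - 1" "a \<le> card ?Y" "1 < card ?Y"
    using fin card_Suc_Diff1[OF fin mX] a by (simp_all add: n_def)
  have a': "a - 1 \<le> card ?Y" using Y by simp
  let ?G = "\<lambda>A. (if Min X \<in> A then c else 0) + run_cost X A"
  have n: "5 < n" using a by (simp add: n_def)
  have "measure_pmf.expectation (random_subset (a - 1) ?Y) (\<lambda>A. ?G (insert (Min X) A)) =
      measure_pmf.expectation (random_subset (a - 1) ?Y) (\<lambda>A. (c + 5) - of_bool (lower 1 ?Y A = {}))"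
    by (rule expectation_random_subset_cong[OF Y(1) a'])
      (use fin ne lower_insert_Min[of X _ 1] in \<open>simp add: run_cost_def numeral_2_eq_2\<close>)
  also have "\<dots> = (c + 5) -
      measure_pmf.expectation (random_subset (a - 1) ?Y) (\<lambda>A. of_bool (lower 1 ?Y A = {}))"
    using integrable_random_subset[OF Y(1) a'] by (subst Bochner_Integration.integral_diff) auto
  finally have E1: "real a * measure_pmf.expectation (random_subset (a - 1) ?Y) (\<lambda>A. ?G (insert (Min X) A)) =
      (c + 5) * real a - real a *
        measure_pmf.expectation (random_subset (a - 1) ?Y) (\<lambda>A. of_bool (lower 1 ?Y A = {}))"
    by (simp only: right_diff_distrib mult.commute[of "real a" "c + 5"])
  \<comment> \<open>The recursion is read backwards, trading the conditional event on
    \<open>?Y\<close> for the known probability on \<open>X\<close>.\<close>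
  have "real a * measure_pmf.expectation (random_subset (a - 1) ?Y) (\<lambda>A. of_bool (lower 1 ?Y A = {})) =
      n * measure_pmf.expectation (random_subset a X) (\<lambda>A. of_bool (lower 2 X A = {}))"
    using expectation_lower_empty_Suc[OF fin ne, of a 1] a by (simp add: n_def numeral_2_eq_2)
  also have "\<dots> = real a * (real a - 1) / (n - 1)"
    using expectation_lower_two_empty[OF fin, of a] a n by (simp add: n_def)
  finally have E1: "real a * measure_pmf.expectation (random_subset (a - 1) ?Y) (\<lambda>A. ?G (insert (Min X) A)) =
      (c + 5) * real a - real a * (real a - 1) / (n - 1)"
    using E1 by simp
  have "measure_pmf.expectation (random_subset a ?Y) ?G =
      measure_pmf.expectation (random_subset a ?Y)
        (\<lambda>A. 4 + real (card (lower 2 ?Y A)) / 2 - 2 * of_bool (lower 2 ?Y A = {}))"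
  proof (rule expectation_random_subset_cong[OF Y(1,3)])
    fix A assume A: "A \<subseteq> ?Y"
    have "finite (lower 2 ?Y A)" using Y(1) lower_subset[of 2 ?Y A] finite_subset by blast
    moreover have "card (lower 2 X A) = Suc (card (lower 2 ?Y A))"
      using card_lower_without_Min[OF fin ne A, of 1] by (simp add: numeral_2_eq_2)
    moreover have "Min X \<notin> A" using A by blast
    ultimately show "?G A = 4 + real (card (lower 2 ?Y A)) / 2 - 2 * of_bool (lower 2 ?Y A = {})"
      by (simp add: run_cost_def field_simps)
  qed
  also have "\<dots> = 4 + measure_pmf.expectation (random_subset a ?Y) (\<lambda>A. real (card (lower 2 ?Y A))) / 2
      - 2 * measure_pmf.expectation (random_subset a ?Y) (\<lambda>A. of_bool (lower 2 ?Y A = {}))"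
    using integrable_random_subset[OF Y(1,3)] by simp
  also have "\<dots> \<le> 4 + (n - 1 - real a) / (real a + 1) -
      2 * (real a * (real a - 1) / ((n - 1) * (n - 2)))"
  proof -
    have "measure_pmf.expectation (random_subset a ?Y) (\<lambda>A. real (card (lower 2 ?Y A)))
        \<le> 2 * ((n - 1 - real a) / (real a + 1))"
      using expectation_card_lower[OF Y(1,3), of 2] unfolding Y(2) by simp
    moreover have "measure_pmf.expectation (random_subset a ?Y) (\<lambda>A. of_bool (lower 2 ?Y A = {}))
        = real a * (real a - 1) / ((n - 1) * (n - 2))"
      using expectation_lower_two_empty[OF Y(1,4) _ Y(3)] a unfolding Y(2) by simp
    ultimately show ?thesis by linarith
  qed
  finally have "(n - real a) * measure_pmf.expectation (random_subset a ?Y) ?G \<le> (n - real a) *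
      (4 + (n - 1 - real a) / (real a + 1) - 2 * (real a * (real a - 1) / ((n - 1) * (n - 2))))"
    using a by (intro mult_left_mono) (auto simp: n_def)
  then show ?thesis
    using expectation_random_subset_split[OF fin mX, of a ?G] E1 a unfolding n_def[symmetric] by simp
qed

theorem theorem6:
  fixes X :: "'a::linorder set" and arr :: "'a set \<Rightarrow> 'a list"
  assumes "finite X" and "arrangement arr"
  shows "measure_pmf.expectation (sample_minimum arr X)
           (\<lambda>(res, cs). real (participations (Min X) cs)) \<le> 9"
  using assms(1)
proof (induction X rule: finite_psubset_induct)
  case (psubset X)
  show ?case
  proof (cases "card X \<le> 8")
    case True
    \<comment> \<open>At most \<open>8 = 2 ^ 3\<close> entries make three rounds.\<close>
    have "participations (Min X) (snd (tournament_minimum (arr X))) \<le> 3"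
      using True psubset.hyps arrangement[OF assms(2) psubset.hyps]
      by (intro participations_tournament_le) auto
    with True show ?thesis by (simp add: sample_minimum.simps[of arr X] split_beta)
  next
    case False
    then have large: "8 < card X" by simp
    let ?E = "measure_pmf.expectation (sample_minimum arr X) (\<lambda>(res, cs). real (participations (Min X) cs))"
    let ?n = "real (card X)" and ?a = "real (half_size (card X))" and ?s = "real (sample_size (card X))"
    have n: "?n = 2 * ?a \<or> ?n + 1 = 2 * ?a"
      by (rule half_size_cases[of "card X"]) linarith+
    have "5 \<le> half_size (card X)" unfolding half_size_def using large by linarith
    then have a: "5 \<le> ?a" by simp
    have s: "4 \<le> ?s" using sample_size_ge_4[OF large] by simp
    have "?n * ?E \<le> ?n * measure_pmf.expectation (random_subset (half_size (card X)) X)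
        (\<lambda>A. (if Min X \<in> A then 9 - ?s / ?a else 0) + run_cost X A)"
      using expectation_sample_minimum_le[OF psubset.hyps assms(2) large psubset.IH]
      by (intro mult_left_mono) auto
    also have "\<dots> \<le> (9 - ?s / ?a + 5) * ?a - ?a * (?a - 1) / (?n - 1) +
        (?n - ?a) * (4 + (?n - 1 - ?a) / (?a + 1) - 2 * (?a * (?a - 1) / ((?n - 1) * (?n - 2))))"
      using a half_size_less[OF large] by (intro expectation_run_cost_le psubset.hyps) auto
    also have "(9 - ?s / ?a + 5) * ?a = 14 * ?a - ?s" using a by (simp add: field_simps)
    also have "14 * ?a - ?s - ?a * (?a - 1) / (?n - 1) +
        (?n - ?a) * (4 + (?n - 1 - ?a) / (?a + 1) - 2 * (?a * (?a - 1) / ((?n - 1) * (?n - 2)))) \<le> 9 * ?n"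
      by (rule expected_cost_bound[OF n a s])
    finally have "?n * ?E \<le> ?n * 9" by (simp add: mult.commute)
    then show ?thesis using large by simp
  qed
qed

end
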